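(* Suppose that the uncertainty set is defined by a single truncated ellipsoidal constraint, i.e. $\mathcal V=\{v\in\mathbb R^{nm}:(v-\bar v)^\top S^{-1}(v-\bar v)\le r^2,\ v\succeq0\}$. The robust utilitarian welfare problem $\max_{a\in\mathcal A}\min_{v\in\mathcal V}w\cdot u(a,v)=\max_{a\in\mathcal A}\min_{v\in\mathcal V}a^\top v$ is equivalent to solving $$\max_{\lambda\in\mathbb R_{\ge0},\ \xi\in\Lambda}\ \ \xi^\top\bar v-\frac{\xi^\top S\xi}{4\lambda}-\lambda r^2. \qquad(\ast)$$ The exact optimal solution $(\lambda^*,\xi^* )$ to $(\ast)$ can be computed by alternately performing two steps until convergence: first, fixing $\xi$ and optimizing $\lambda$, i.e. $\lambda=\xi^\top S\xi/(2r)$; and second, fixing $\lambda$ and solving a concave quadratic program to optimize $\xi$. The optimal allocation $a^*$ can be computed from $\xi^*$ by finding $a\in\mathcal A$ such that $a_G\preceq\xi^*_G$ for every group $G\in\mathcal G$.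
   Context: There are $n$ agents $N$, partitioned into groups $\mathcal G=\{G_1,\dots,G_g\}$, and $m$ item types $I$. Allocations and valuations are $n\times m$ matrices, vectorized in row-major order as $a,v\in\mathbb R^{nm}$; $x_G\in\mathbb R^{|G|m}$ is the restriction of a vector $x$ to the agents in $G$; $x_{j,i}$ is the entry of $x$ for agent $j$ and item $i$. $\succeq,\preceq$ are coordinatewise. The set of feasible (continuous) allocations $\mathcal A$ consists of all $a\in\mathbb R_{\ge0}^{nm}$ with $\underline\kappa_j\le\sum_{i\in I}a_{j,i}\le\bar\kappa_j$ for each agent $j$, $\underline\psi_i\le\sum_{j\in N}a_{j,i}\le\bar\psi_i$ for each item $i$, and $a\preceq c$, for given bounds $\underline\kappa,\bar\kappa,\underline\psi,\bar\psi,c$. Group utilities are $u_G(a,v)=a_G^\top v_G/|G|$, and weighted utilitarian welfare is $w\cdot u=\sum_G w_Gu_G$; without loss of generality $w_G=|G|$, so welfare equals $a^\top v$. The data of $\mathcal V$ are a center $\bar v\in\mathbb R_{\ge0}^{nm}$, a positive semi-definite covariance matrix $S\in\mathbb R^{nm\times nm}$ (whose inverse is used) and a radius $r\in\mathbb R$; the inner minimization over $\mathcal V$ is taken to be strictly feasible (Slater's condition). The set $\Lambda$ is given as $$\Lambda\doteq\mathcal A-\mathbb R_{\ge0}^{nm}=\Bigl\{\xi\in\mathbb R^{nm}:\ \sum_{i\in I}\xi_{j,i}\le\bar\kappa_j\ \forall j\in N,\ \ \sum_{j\in N}\xi_{j,i}\le\bar\psi_i\ \forall i\in I,\ \ \xi\preceq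 c\Bigr\}.$$
   Formalization: Corrected: the λ-step is λ=√(ξᵀSξ)/(2|r|); recovery uses ξ*_G ⪯ a_G, not a_G ⪯ ξ*_G; Λ is A−R≥0, since the explicit inequality set can be larger; alternation starts at ξ≠0, as it is stuck at 0; at λ=0 the quotient is 0 if ξᵀSξ=0, else +∞. *)

theory Defs
  imports "HOL-Analysis.Analysis" "HOL-Library.Disjoint_Sets"
begin

text \<open>Agents are the elements of a finite type \<open>'n\<close>, item types those of a finite type \<open>'m\<close>.
  A vectorized \<open>n \<times> m\<close> matrix is a vector \<open>x\<close> indexed by pairs, with entries \<open>x $ (j, i)\<close>, and
  \<open>\<le>\<close> on vectors is the coordinatewise order.\<close>

definition feasible_allocations ::
  "real^'n::finite \<Rightarrow> real^'n \<Rightarrow> real^'m::finite \<Rightarrow> real^'m \<Rightarrow> real^('n \<times> 'm) \<Rightarrow> (real^('n \<times> 'm)) set" where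
  "feasible_allocations \<kappa>l \<kappa>u \<psi>l \<psi>u c = {a. 0 \<le> a \<and> a \<le> c
     \<and> (\<forall>j. \<kappa>l $ j \<le> (\<Sum>i\<in>UNIV. a $ (j, i)) \<and> (\<Sum>i\<in>UNIV. a $ (j, i)) \<le> \<kappa>u $ j)
     \<and> (\<forall>i. \<psi>l $ i \<le> (\<Sum>j\<in>UNIV. a $ (j, i)) \<and> (\<Sum>j\<in>UNIV. a $ (j, i)) \<le> \<psi>u $ i)}"

text \<open>The restriction \<open>x\<^sub>G\<close>, encoded by padding with zeros outside \<open>G\<close>. This preserves inner
  products and the coordinatewise order.\<close>

definition group_restrict :: "'n::finite set \<Rightarrow> real^('n \<times> 'm::finite) \<Rightarrow> real^('n \<times> 'm)" where
  "group_restrict G x = (\<chi> p. if fst p \<in> G then x $ p else 0)"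

definition group_utility :: "'n::finite set \<Rightarrow> real^('n \<times> 'm::finite) \<Rightarrow> real^('n \<times> 'm) \<Rightarrow> real" where
  "group_utility G a v = (group_restrict G a \<bullet> group_restrict G v) / real (card G)"

definition welfare ::
  "'n::finite set set \<Rightarrow> ('n set \<Rightarrow> real) \<Rightarrow> real^('n \<times> 'm::finite) \<Rightarrow> real^('n \<times> 'm) \<Rightarrow> real" where
  "welfare \<G> w a v = (\<Sum>G\<in>\<G>. w G * group_utility G a v)"

definition pos_semidef :: "real^'k^'k \<Rightarrow> bool" where
  "pos_semidef S \<longleftrightarrow> transpose S = S \<and> (\<forall>x. 0 \<le> x \<bullet> (S *v x))"

definition ellipsoid_form :: "real^'k \<Rightarrow> real^'k^'k \<Rightarrow> real^'k \<Rightarrow> real" where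
  "ellipsoid_form vbar S v = (v - vbar) \<bullet> (matrix_inv S *v (v - vbar))"

definition truncated_ellipsoid :: "real^'k \<Rightarrow> real^'k^'k \<Rightarrow> real \<Rightarrow> (real^'k) set" where
  "truncated_ellipsoid vbar S r = {v. ellipsoid_form vbar S v \<le> r\<^sup>2 \<and> 0 \<le> v}"

text \<open>\<open>\<Lambda>\<close> is the elementwise difference of \<open>A\<close> and the nonnegative orthant. The set cut out by the upper bounds of \<open>A\<close>
  alone can be strictly larger: negative entries of a vector may offset entries that no
  nonnegative allocation within those bounds can dominate.\<close>

definition downward_closure :: "(real^'k) set \<Rightarrow> (real^'k) set" where
  "downward_closure A = {a - b | a b. a \<in> A \<and> 0 \<le> b}"

text \<open>The quotient is taken in the extended reals, where \<open>0 / 0 = 0\<close> and \<open>q / 0 = \<infinity>\<close> for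
  \<open>q > 0\<close>. At \<open>l = 0\<close> the objective is therefore the infimum over all \<open>v\<close> of the Lagrangian
  with zero multiplier for the ellipsoidal constraint: \<open>-\<infinity>\<close> unless \<open>x \<bullet> (S *v x) = 0\<close>. Real
  division would instead drop the quadratic term at \<open>l = 0\<close>.\<close>

definition dual_objective :: "real^'k \<Rightarrow> real^'k^'k \<Rightarrow> real \<Rightarrow> real \<Rightarrow> real^'k \<Rightarrow> ereal" where
  "dual_objective vbar S r l x =
     ereal (x \<bullet> vbar) - ereal (x \<bullet> (S *v x)) / ereal (4 * l) - ereal (l * r\<^sup>2)"

definition dual_optimal ::
  "(real^'k) set \<Rightarrow> real^'k \<Rightarrow> real^'k^'k \<Rightarrow> real \<Rightarrow> real \<Rightarrow> real^'k \<Rightarrow> bool" where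
  "dual_optimal \<Lambda> vbar S r l x \<longleftrightarrow>
     is_arg_max (\<lambda>(l, x). dual_objective vbar S r l x) (\<lambda>(l, x). 0 \<le> l \<and> x \<in> \<Lambda>) (l, x)"

definition robust_optimal ::
  "(real^'k) set \<Rightarrow> (real^'k) set \<Rightarrow> (real^'k \<Rightarrow> real^'k \<Rightarrow> real) \<Rightarrow> real^'k \<Rightarrow> bool" where
  "robust_optimal A V W a \<longleftrightarrow> is_arg_max (\<lambda>a. INF v\<in>V. ereal (W a v)) (\<lambda>a. a \<in> A) a"

definition multiplier_step :: "real^'k \<Rightarrow> real^'k^'k \<Rightarrow> real \<Rightarrow> real^'k \<Rightarrow> real \<Rightarrow> bool" where
  "multiplier_step vbar S r x l \<longleftrightarrow>
     is_arg_max (\<lambda>l. dual_objective vbar S r l x) (\<lambda>l. 0 \<le> l) l"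

definition quadratic_step ::
  "(real^'k) set \<Rightarrow> real^'k \<Rightarrow> real^'k^'k \<Rightarrow> real \<Rightarrow> real \<Rightarrow> real^'k \<Rightarrow> bool" where
  "quadratic_step \<Lambda> vbar S r l x \<longleftrightarrow>
     is_arg_max (\<lambda>x. dual_objective vbar S r l x) (\<lambda>x. x \<in> \<Lambda>) x"

definition alternating_run ::
  "(real^'k) set \<Rightarrow> real^'k \<Rightarrow> real^'k^'k \<Rightarrow> real \<Rightarrow> (nat \<Rightarrow> real) \<Rightarrow> (nat \<Rightarrow> real^'k) \<Rightarrow> bool" where
  "alternating_run \<Lambda> vbar S r l x \<longleftrightarrow> x 0 \<in> \<Lambda>
     \<and> (\<forall>k. multiplier_step vbar S r (x k) (l k))
     \<and> (\<forall>k. quadratic_step \<Lambda> vbar S r (l k) (x (Suc k)))"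

end

theory Submission
  imports Defs
begin

text \<open>Write \<open>q x = sqrt (x \<bullet> (S *v x))\<close>. Maximizing the dual objective over the multiplier leaves
  \<open>h x = x \<bullet> vbar - \<bar>r\<bar> * q x\<close>, the minimum of \<open>x \<bullet> v\<close> over the full ellipsoid. Lagrange duality for the
  constraint \<open>0 \<le> v\<close> shows that the robust value of \<open>a\<close> is the largest \<open>h x\<close> with \<open>x \<le> a\<close>, so the
  robust problem is the maximization of \<open>h\<close> over the downward closure of the feasible set.

  For the alternating iteration, put \<open>q\<^sub>k = q (x k)\<close>. The first-order condition of the quadratic step gives
  \<open>q\<^sub>k * (h y - h (x (k+1))) \<le> \<bar>r\<bar> * (q\<^sub>k\<^sub>+\<^sub>1 - q\<^sub>k) * (q y - q\<^sub>k\<^sub>+\<^sub>1)\<close> for every feasible \<open>y\<close>, and the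
  ascent of \<open>h\<close> controls \<open>(q\<^sub>k\<^sub>+\<^sub>1 - q\<^sub>k)\<^sup>2\<close>. If \<open>q\<^sub>k\<close> stays away from 0, the right-hand side divided by
  \<open>q\<^sub>k\<close> tends to 0; otherwise new minima of \<open>q\<^sub>k\<close> make it arbitrarily small. Either way \<open>h (x k)\<close> tends to
  the maximum. Maximizers lie on a common ray, and only the one of norm \<open>lim q\<^sub>k\<close> can be a limit point:
  \<open>h\<close> is positively homogeneous, so a positive maximum is attained at one point, while if the maximum
  is 0 the sequence \<open>q\<^sub>k\<close> is decreasing.\<close>

subsection \<open>Polyhedrality of the downward closure\<close>

text \<open>Fixing the first component turns each halfspace into a halfspace of the second factor.
  Its normal \<open>snd a\<close> may vanish; the slice is then empty or the whole space, still a
  polyhedron.\<close>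

lemma polyhedron_Pair_preimage:
  fixes C :: "('a::euclidean_space \<times> 'b::euclidean_space) set"
  assumes "polyhedron C"
  shows "polyhedron {x. (t, x) \<in> C}"
proof -
  obtain F where F: "finite F" "C = \<Inter>F"
    "\<And>h. h \<in> F \<Longrightarrow> \<exists>a b. a \<noteq> 0 \<and> h = {x. a \<bullet> x \<le> b}"
    using assms unfolding polyhedron_def by metis
  have "polyhedron (\<Inter>h\<in>F. {x. (t, x) \<in> h})"
  proof (rule polyhedron_Inter)
    show "finite ((\<lambda>h. {x. (t, x) \<in> h}) ` F)" using F(1) by simp
    fix T assume "T \<in> (\<lambda>h. {x. (t, x) \<in> h}) ` F"
    then obtain h where h: "h \<in> F" "T = {x. (t, x) \<in> h}" by auto
    obtain a b where "h = {x. a \<bullet> x \<le> b}" using F(3)[OF h(1)] by auto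
    then have "T = {x. snd a \<bullet> x \<le> b - fst a \<bullet> t}"
      using h(2) by (auto simp: inner_prod_def)
    then show "polyhedron T" by (simp add: polyhedron_halfspace_le)
  qed
  moreover have "(\<Inter>h\<in>F. {x. (t, x) \<in> h}) = {x. (t, x) \<in> C}"
    using F(2) by auto
  ultimately show ?thesis by simp
qed

text \<open>Presents the recession directions of a downward closure as a finitely generated cone. A
  point \<open>x \<le> 0\<close> has the nonnegative coefficients \<open>- x $ p\<close>.\<close>

lemma convex_cone_hull_neg_axes:
  "convex_cone hull (range (\<lambda>p::'k::finite. (0::real, - axis p 1 :: real^'k))) = {0} \<times> {x. x \<le> 0}"
  (is "convex_cone hull ?R = ?N")
proof (rule antisym)
  have "convex_cone ?N"
    by (auto simp: convex_cone_def conic_def convex_def zero_prod_def less_eq_vec_def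
        mult_nonneg_nonpos add_nonpos_nonpos intro: exI[of _ 0])
  moreover have "?R \<subseteq> ?N"
    by (auto simp: less_eq_vec_def axis_def)
  ultimately show "convex_cone hull ?R \<subseteq> ?N" by (rule hull_minimal[rotated])
  show "?N \<subseteq> convex_cone hull ?R"
  proof clarify
    fix x :: "real^'k" assume x: "x \<le> 0"
    have sums: "(\<Sum>p\<in>I. (- x $ p) *\<^sub>R (0::real, - axis p 1 :: real^'k)) \<in> convex_cone hull ?R"
      if "finite I" for I
      using that
    proof induction
      case empty
      show ?case using convex_cone_hull_contains_0 by simp
    next
      case (insert p I)
      have "(- x $ p) *\<^sub>R (0::real, - axis p 1 :: real^'k) \<in> convex_cone hull ?R"
        using x by (intro convex_cone_hull_mul hull_inc) (auto simp: less_eq_vec_def)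
      then show ?case using insert by (simp add: convex_cone_hull_add)
    qed
    have "(\<Sum>p\<in>UNIV. (- x $ p) *\<^sub>R (0::real, - axis p 1 :: real^'k)) = (0, x)"
      by (simp add: prod_eq_iff fst_sum snd_sum vec_eq_iff axis_def if_distrib cong: if_cong)
    then show "(0, x) \<in> convex_cone hull ?R" using sums[of UNIV] by simp
  qed
qed

text \<open>Homogenization: \<open>downward_closure A\<close> is the slice at height 1 of the finitely generated cone
  spanned by \<open>(1, a)\<close> for the vertices \<open>a\<close> of \<open>A\<close> and by \<open>(0, - axis p 1)\<close>.\<close>

lemma polyhedron_downward_closure:
  fixes A :: "(real^'k) set"
  assumes "polytope A"
  shows "polyhedron (downward_closure A)"
proof (cases "A = {}")
  case True
  then show ?thesis by (simp add: downward_closure_def)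
next
  case False
  obtain F where F: "finite F" "A = convex hull F" using assms unfolding polytope_def by blast
  define P where "P = Pair (1::real) ` F"
  define C where "C = convex_cone hull (P \<union> range (\<lambda>p. (0::real, - axis p 1 :: real^'k)))"
  \<comment> \<open>\<open>Pair 1\<close> is affine but not linear, so it is factored into the
    linear map \<open>Pair 0\<close> and a translation.\<close>
  have hull_P: "convex hull P = Pair 1 ` A"
  proof -
    have "Pair (1::real) ` T = (+) (1, 0) ` (Pair 0 ` T)" for T :: "(real^'k) set" by force
    moreover have "linear (Pair (0::real) :: real^'k \<Rightarrow> _)"
      by (rule linearI) auto
    ultimately show ?thesis unfolding P_def F(2)
      by (simp add: convex_hull_linear_image convex_hull_translation)
  qed
  have cone_P: "convex_cone hull P = {c *\<^sub>R (1, a) | c a. 0 \<le> c \<and> a \<in> A}"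
    using False F(2) unfolding P_def
    by (subst convex_cone_hull_convex_hull_nonempty)
       (auto simp: hull_P[unfolded P_def] )
  have "polyhedron C" unfolding C_def P_def using F(1) by (intro polyhedron_convex_cone_hull) auto
  moreover have "downward_closure A = {x. (1, x) \<in> C}"
  proof (intro set_eqI iffI)
    fix x assume "x \<in> downward_closure A"
    then obtain a b where "a \<in> A" "0 \<le> b" "x = a - b" by (auto simp: downward_closure_def)
    then have "(1, x) = 1 *\<^sub>R (1, a) + (0, - b)" "- b \<le> 0" by auto
    moreover have "1 *\<^sub>R (1, a) \<in> convex_cone hull P"
      unfolding cone_P using \<open>a \<in> A\<close> zero_le_one by blast
    ultimately show "x \<in> {x. (1, x) \<in> C}"
      unfolding C_def convex_cone_hull_Un convex_cone_hull_neg_axes by blast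
  next
    fix x assume "x \<in> {x. (1, x) \<in> C}"
    \<comment> \<open>The second summand has height 0, so height 1 forces the scaling factor of the
      first summand to be 1.\<close>
    then obtain a n where "a \<in> A" "n \<le> 0" "x = a + n"
      unfolding C_def convex_cone_hull_Un cone_P convex_cone_hull_neg_axes by auto
    then have "x = a - (- n)" "0 \<le> - n" by auto
    with \<open>a \<in> A\<close> show "x \<in> downward_closure A" unfolding downward_closure_def by blast
  qed
  ultimately show ?thesis by (simp add: polyhedron_Pair_preimage)
qed

text \<open>Nonnegativity and the cap \<open>c\<close> give a bounded box. Row and column sums are
  inner products with indicator vectors, so the other constraints are halfspaces.\<close>

lemma polytope_feasible_allocations:
  fixes c :: "real^('n::finite \<times> 'm::finite)"
  shows "polytope (feasible_allocations \<kappa>l \<kappa>u \<psi>l \<psi>u c)"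
proof -
  have row: "(\<Sum>i\<in>UNIV. a $ (j, i)) = (\<chi> p. if fst p = j then 1 else 0) \<bullet> (a :: real^('n \<times> 'm))" for a j
  proof -
    have "(\<chi> p. if fst p = j then 1 else 0) \<bullet> a = (\<Sum>p\<in>UNIV. if fst p = j then a $ p else 0)"
      by (simp add: inner_vec_def if_distrib if_distribR cong: if_cong)
    also have "\<dots> = (\<Sum>j'\<in>UNIV. \<Sum>i\<in>UNIV. if j' = j then a $ (j', i) else 0)"
      by (simp only: sum.cartesian_product UNIV_Times_UNIV)
         (auto intro!: sum.cong)
    also have "\<dots> = (\<Sum>i\<in>UNIV. a $ (j, i))"
      by (subst sum.swap) simp
    finally show ?thesis by simp
  qed
  have col: "(\<Sum>j\<in>UNIV. a $ (j, i)) = (\<chi> p. if snd p = i then 1 else 0) \<bullet> (a :: real^('n \<times> 'm))" for a i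
  proof -
    have "(\<chi> p. if snd p = i then 1 else 0) \<bullet> a = (\<Sum>p\<in>UNIV. if snd p = i then a $ p else 0)"
      by (simp add: inner_vec_def if_distrib if_distribR cong: if_cong)
    also have "\<dots> = (\<Sum>j\<in>UNIV. \<Sum>i'\<in>UNIV. if i' = i then a $ (j, i') else 0)"
      by (simp only: sum.cartesian_product UNIV_Times_UNIV)
         (auto intro!: sum.cong)
    also have "\<dots> = (\<Sum>j\<in>UNIV. a $ (j, i))" by simp
    finally show ?thesis by simp
  qed
  have "feasible_allocations \<kappa>l \<kappa>u \<psi>l \<psi>u c = cbox 0 c \<inter>
     ((\<Inter>j. {a. (\<chi> p. if fst p = j then 1 else 0) \<bullet> a \<ge> \<kappa>l $ j}) \<inter>
      (\<Inter>j. {a. (\<chi> p. if fst p = j then 1 else 0) \<bullet> a \<le> \<kappa>u $ j}) \<inter>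
      (\<Inter>i. {a. (\<chi> p. if snd p = i then 1 else 0) \<bullet> a \<ge> \<psi>l $ i}) \<inter>
      (\<Inter>i. {a. (\<chi> p. if snd p = i then 1 else 0) \<bullet> a \<le> \<psi>u $ i}))"
    unfolding feasible_allocations_def row[symmetric] col[symmetric]
    by (auto simp: mem_box_cart less_eq_vec_def)
  also have "polytope \<dots>"
    by (intro polytope_Int_polyhedron polytope_interval polyhedron_Int polyhedron_Inter)
       (auto simp: polyhedron_halfspace_le polyhedron_halfspace_ge)
  finally show ?thesis .
qed

subsection \<open>The covariance norm and the ellipsoid\<close>

lemma matrix_inv_mult_vec:
  fixes S :: "real^'k^'k"
  assumes "invertible S"
  shows "S *v (matrix_inv S *v x) = x" "matrix_inv S *v (S *v x) = x"
proof -
  have "S ** matrix_inv S = mat 1 \<and> matrix_inv S ** S = mat 1"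
    using assms unfolding invertible_def matrix_inv_def by (rule someI_ex)
  then show "S *v (matrix_inv S *v x) = x" "matrix_inv S *v (S *v x) = x"
    by (metis matrix_vector_mul_assoc matrix_vector_mul_lid)+
qed

locale covariance_ellipsoid =
  fixes vbar :: "real^'k" and S :: "real^'k^'k" and r :: real
  assumes pos_semidef: "pos_semidef S" and invertible: "invertible S"
begin

definition cov_norm :: "real^'k \<Rightarrow> real" where
  "cov_norm x = sqrt (x \<bullet> (S *v x))"

text \<open>The radius enters as \<open>\<bar>r\<bar>\<close> because the ellipsoid depends on the
  square of \<open>r\<close> only and \<open>r\<close> may be negative.\<close>

definition worst_value :: "real^'k \<Rightarrow> real" where
  "worst_value x = x \<bullet> vbar - \<bar>r\<bar> * cov_norm x"

lemma inner_S_commute: "x \<bullet> (S *v y) = y \<bullet> (S *v x)"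
proof -
  have "transpose S = S" using pos_semidef by (simp add: pos_semidef_def)
  then have "y v* S = S *v y" by (metis vector_transpose_matrix)
  then show ?thesis by (metis dot_lmul_matrix inner_commute)
qed

lemma inner_S_nonneg: "0 \<le> x \<bullet> (S *v x)"
  using pos_semidef by (simp add: pos_semidef_def)

lemma quad_form_linear_combination:
  "(s *\<^sub>R x + t *\<^sub>R y) \<bullet> (S *v (s *\<^sub>R x + t *\<^sub>R y))
    = s\<^sup>2 * (x \<bullet> (S *v x)) + 2 * s * t * (x \<bullet> (S *v y)) + t\<^sup>2 * (y \<bullet> (S *v y))"
  by (simp add: matrix_vector_right_distrib matrix_vector_mult_scaleR
      inner_S_commute[of y x] power2_eq_square algebra_simps)

text \<open>Semidefiniteness and invertibility together give definiteness. If the form vanishes at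
  \<open>x\<close>, then at \<open>x + t *\<^sub>R (S *v x)\<close> its linear term in
  \<open>t\<close> must vanish too, and the coefficient of that term is a multiple of the squared
  length of \<open>S *v x\<close>.\<close>

lemma quad_form_eq_0_iff: "x \<bullet> (S *v x) = 0 \<longleftrightarrow> x = 0"
proof
  assume x: "x \<bullet> (S *v x) = 0"
  define z where "z = S *v x"
  define b d where "b = z \<bullet> z" and "d = z \<bullet> (S *v z)"
  have d: "0 \<le> d" by (simp add: d_def inner_S_nonneg)
  have "x \<bullet> (S *v z) = b" using inner_S_commute[of x z] by (simp add: b_def z_def)
  then have "0 \<le> 2 * t * b + t\<^sup>2 * d" for t
    using inner_S_nonneg[of "1 *\<^sub>R x + t *\<^sub>R z"] x
    unfolding quad_form_linear_combination d_def by simp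
  \<comment> \<open>The denominator \<open>d + 1\<close> covers \<open>d = 0\<close> as well, and
    with this \<open>t\<close> the polynomial becomes
    \<open>- (t\<^sup>2 * (d + 2))\<close>.\<close>
  moreover define t where "t = - b / (d + 1)"
  moreover have b: "b = - (t * (d + 1))" using d by (simp add: t_def)
  ultimately have "0 \<le> 2 * t * (- (t * (d + 1))) + t\<^sup>2 * d" by metis
  also have "\<dots> = - (t\<^sup>2 * (d + 2))" by (simp add: power2_eq_square algebra_simps)
  finally have "t = 0" using d by (simp add: mult_le_0_iff)
  then have "b = 0" using b by simp
  then have "S *v x = 0" by (simp add: b_def z_def)
  then show "x = 0" using matrix_inv_mult_vec(2)[OF invertible, of x] by simp
qed simp

lemma cov_norm_square: "(cov_norm x)\<^sup>2 = x \<bullet> (S *v x)"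
  by (simp add: cov_norm_def inner_S_nonneg)

lemma cov_norm_nonneg [simp]: "0 \<le> cov_norm x"
  by (simp add: cov_norm_def inner_S_nonneg)

lemma cov_norm_eq_0_iff [simp]: "cov_norm x = 0 \<longleftrightarrow> x = 0"
  by (simp add: cov_norm_def quad_form_eq_0_iff)

lemma cov_norm_zero [simp]: "cov_norm 0 = 0"
  by simp

lemma cov_norm_pos_iff: "0 < cov_norm x \<longleftrightarrow> x \<noteq> 0"
  using cov_norm_nonneg[of x] cov_norm_eq_0_iff[of x] by linarith

lemma cov_norm_scaleR: "cov_norm (t *\<^sub>R x) = \<bar>t\<bar> * cov_norm x"
  by (simp add: cov_norm_def matrix_vector_mult_scaleR real_sqrt_mult flip: mult.assoc)

text \<open>The source of both Cauchy-Schwarz and its equality case: the left side is a square, and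
  it vanishes only if \<open>x\<close> and \<open>y\<close> are on a common ray or one of them is
  0.\<close>

lemma cov_norm_diff_scaled_square:
  "(cov_norm (cov_norm y *\<^sub>R x - cov_norm x *\<^sub>R y))\<^sup>2
    = 2 * (cov_norm x * cov_norm y) * (cov_norm x * cov_norm y - x \<bullet> (S *v y))"
  using quad_form_linear_combination[of "cov_norm y" x "- cov_norm x" y]
  by (simp add: cov_norm_square[symmetric]) (simp add: power2_eq_square algebra_simps)

lemma inner_S_le: "x \<bullet> (S *v y) \<le> cov_norm x * cov_norm y"
proof (cases "x = 0 \<or> y = 0")
  case False
  then have "0 < cov_norm x * cov_norm y" by (simp add: cov_norm_pos_iff)
  moreover have "0 \<le> 2 * (cov_norm x * cov_norm y) * (cov_norm x * cov_norm y - x \<bullet> (S *v y))"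
    unfolding cov_norm_diff_scaled_square[symmetric] by simp
  ultimately show ?thesis by (simp add: zero_le_mult_iff)
qed auto

lemma cov_norm_triangle: "cov_norm (x + y) \<le> cov_norm x + cov_norm y"
proof (rule power2_le_imp_le)
  show "(cov_norm (x + y))\<^sup>2 \<le> (cov_norm x + cov_norm y)\<^sup>2"
    using quad_form_linear_combination[of 1 x 1 y] inner_S_le[of x y]
    by (simp add: cov_norm_square[symmetric] power2_sum)
qed simp

text \<open>Cauchy-Schwarz for \<open>x\<close> and \<open>P *v x\<close> bounds the squared norm of
  \<open>x\<close> by \<open>cov_norm x * cov_norm (P *v x)\<close>, and the operator bound on
  \<open>P\<close> bounds the last factor by \<open>sqrt K * norm x\<close>.\<close>

lemma norm_le_cov_norm: "\<exists>K>0. \<forall>x. norm x \<le> K * cov_norm x"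
proof -
  define P where "P = matrix_inv S"
  obtain K where K: "0 < K" "\<And>x. norm (P *v x) \<le> norm x * K"
    using bounded_linear.pos_bounded[OF matrix_vector_mul_bounded_linear[of P]] by blast
  have SP: "S *v (P *v x) = x" for x
    unfolding P_def by (rule matrix_inv_mult_vec(1)[OF invertible])
  have "norm x \<le> sqrt K * cov_norm x" for x
  proof (cases "x = 0")
    case False
    have "(cov_norm (P *v x))\<^sup>2 = (P *v x) \<bullet> x" by (simp add: cov_norm_square SP)
    also have "\<dots> \<le> norm (P *v x) * norm x" by (rule norm_cauchy_schwarz)
    also have "\<dots> \<le> norm x * K * norm x" using K(2) by (intro mult_right_mono) auto
    also have "\<dots> = (sqrt K * norm x)\<^sup>2" using K(1) by (simp add: power2_eq_square)
    finally have le: "cov_norm (P *v x) \<le> sqrt K * norm x"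
      by (rule power2_le_imp_le) (use K in simp)
    have "norm x * norm x = x \<bullet> (S *v (P *v x))" by (simp add: SP power2_norm_eq_inner flip: power2_eq_square)
    also have "\<dots> \<le> cov_norm x * cov_norm (P *v x)" by (rule inner_S_le)
    also have "\<dots> \<le> cov_norm x * (sqrt K * norm x)" using le by (intro mult_left_mono) auto
    finally have "norm x * norm x \<le> (sqrt K * cov_norm x) * norm x" by (simp add: ac_simps)
    then show ?thesis using False by simp
  qed simp
  then show ?thesis using K(1) by (metis real_sqrt_gt_0_iff)
qed

lemma continuous_on_quad_form [continuous_intros]:
  "continuous_on T f \<Longrightarrow> continuous_on T (\<lambda>x. f x \<bullet> (S *v f x))"
  by (intro continuous_on_inner continuous_on_compose2[of UNIV "(*v) S" T f]
      matrix_vector_mult_linear_continuous_on) auto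

lemma continuous_on_cov_norm [continuous_intros]:
  "continuous_on T f \<Longrightarrow> continuous_on T (\<lambda>x. cov_norm (f x))"
  unfolding cov_norm_def by (intro continuous_intros)

text \<open>The ellipsoid thereby becomes the preimage of a \<open>cov_norm\<close> ball under an
  affine map, so its geometry reduces to that of \<open>cov_norm\<close>.\<close>

lemma ellipsoid_form_eq: "ellipsoid_form vbar S v = (cov_norm (matrix_inv S *v (v - vbar)))\<^sup>2"
  by (simp add: ellipsoid_form_def cov_norm_square matrix_inv_mult_vec[OF invertible] inner_commute)

lemma ellipsoid_form_le_iff:
  "ellipsoid_form vbar S v \<le> s\<^sup>2 \<longleftrightarrow> cov_norm (matrix_inv S *v (v - vbar)) \<le> \<bar>s\<bar>"
  unfolding ellipsoid_form_eq by (simp add: abs_le_square_iff[symmetric])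

text \<open>Cauchy-Schwarz for \<open>- x\<close> against \<open>matrix_inv S *v (v - vbar)\<close>.
  Keeping the actual form of \<open>v\<close> in place of the radius is what makes coercivity
  available at a strictly interior point.\<close>

lemma inner_ellipsoid_ge:
  "x \<bullet> vbar - cov_norm x * sqrt (ellipsoid_form vbar S v) \<le> x \<bullet> v"
proof -
  have "(- x) \<bullet> (v - vbar) = (- x) \<bullet> (S *v (matrix_inv S *v (v - vbar)))"
    by (simp add: matrix_inv_mult_vec[OF invertible])
  also have "\<dots> \<le> cov_norm (- x) * cov_norm (matrix_inv S *v (v - vbar))" by (rule inner_S_le)
  also have "\<dots> = cov_norm x * sqrt (ellipsoid_form vbar S v)"
    using cov_norm_scaleR[of "-1" x] by (simp add: ellipsoid_form_eq)
  finally show ?thesis by (simp add: inner_diff_right)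
qed

lemma worst_value_le_inner:
  assumes "ellipsoid_form vbar S v \<le> r\<^sup>2"
  shows "worst_value x \<le> x \<bullet> v"
proof -
  have "sqrt (ellipsoid_form vbar S v) \<le> \<bar>r\<bar>" using real_sqrt_le_mono[OF assms] by simp
  then have "cov_norm x * sqrt (ellipsoid_form vbar S v) \<le> cov_norm x * \<bar>r\<bar>"
    by (intro mult_left_mono) auto
  then show ?thesis using inner_ellipsoid_ge[of x v] by (simp add: worst_value_def mult.commute)
qed

text \<open>Equality in Cauchy-Schwarz asks for \<open>v - vbar\<close> to be a nonpositive multiple
  of \<open>S *v x\<close>; the factor \<open>t\<close> places \<open>v\<close> on the boundary of
  the ellipsoid.\<close>

lemma worst_value_attained: "\<exists>v. ellipsoid_form vbar S v \<le> r\<^sup>2 \<and> x \<bullet> v = worst_value x"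
proof (cases "x = 0")
  case True
  then show ?thesis
    by (intro exI[of _ vbar]) (auto simp: ellipsoid_form_def worst_value_def)
next
  case False
  define t where "t = \<bar>r\<bar> / cov_norm x"
  have q: "0 < cov_norm x" using False by (simp add: cov_norm_pos_iff)
  have "matrix_inv S *v ((vbar - t *\<^sub>R (S *v x)) - vbar) = (- t) *\<^sub>R x"
    using matrix_vector_mult_scaleR[of "matrix_inv S" "- t" "S *v x"]
    by (simp add: matrix_inv_mult_vec(2)[OF invertible])
  then have "cov_norm (matrix_inv S *v ((vbar - t *\<^sub>R (S *v x)) - vbar)) = \<bar>r\<bar>"
    using False by (simp add: cov_norm_scaleR t_def del: scaleR_minus_left)
  then have "ellipsoid_form vbar S (vbar - t *\<^sub>R (S *v x)) \<le> r\<^sup>2"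
    by (simp add: ellipsoid_form_le_iff)
  moreover have "x \<bullet> (vbar - t *\<^sub>R (S *v x)) = worst_value x"
    using q by (simp add: worst_value_def t_def inner_diff_right cov_norm_square[symmetric] power2_eq_square)
  ultimately show ?thesis by blast
qed

end

subsection \<open>Duality\<close>

text \<open>Serves to read off the signs of a separating normal along rays contained in the
  separated set.\<close>

lemma affine_nonneg_imp_slope_nonneg:
  fixes c m :: real
  assumes "\<And>s. 0 \<le> s \<Longrightarrow> 0 \<le> c + s * m"
  shows "0 \<le> m"
proof (rule ccontr)
  assume "\<not> 0 \<le> m"
  then have m: "m < 0" by simp
  then have "0 \<le> - (\<bar>c\<bar> + 1) / m" by (intro divide_nonpos_neg) auto
  from assms[OF this] show False using m by simp
qed

lemma inner_nonneg_vec: "0 \<le> x \<Longrightarrow> 0 \<le> y \<Longrightarrow> 0 \<le> x \<bullet> (y :: real^'k)"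
  by (auto simp: inner_vec_def less_eq_vec_def intro!: sum_nonneg)

locale slater_ellipsoid = covariance_ellipsoid vbar S r
  for vbar :: "real^'k" and S r +
  fixes v0 :: "real^'k"
  assumes v0_form: "ellipsoid_form vbar S v0 < r\<^sup>2" and v0_pos: "\<And>p. 0 < v0 $ p"
begin

lemma r_nonzero: "r \<noteq> 0"
  using v0_form by (auto simp: ellipsoid_form_eq)

lemma v0_nonneg: "0 \<le> v0"
  using v0_pos by (simp add: less_eq_vec_def less_imp_le)

lemma convex_ellipsoid: "convex {v. ellipsoid_form vbar S v \<le> r\<^sup>2}"
proof (rule convexI; clarsimp simp: ellipsoid_form_le_iff)
  fix x y :: "real^'k" and s t :: real
  let ?P = "\<lambda>v. cov_norm (matrix_inv S *v (v - vbar))"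
  assume x: "?P x \<le> \<bar>r\<bar>" and y: "?P y \<le> \<bar>r\<bar>" and st: "0 \<le> s" "0 \<le> t" "s + t = 1"
  have "s *\<^sub>R x + t *\<^sub>R y - vbar = s *\<^sub>R (x - vbar) + t *\<^sub>R (y - vbar)"
  proof -
    have "s *\<^sub>R vbar + t *\<^sub>R vbar = vbar" using st(3) by (metis scaleR_add_left scaleR_one)
    then show ?thesis by (simp add: scaleR_diff_right algebra_simps)
  qed
  then have "?P (s *\<^sub>R x + t *\<^sub>R y) \<le> s * ?P x + t * ?P y"
    using cov_norm_triangle[of "s *\<^sub>R (matrix_inv S *v (x - vbar))" "t *\<^sub>R (matrix_inv S *v (y - vbar))"] st
    by (simp add: matrix_vector_right_distrib matrix_vector_mult_scaleR cov_norm_scaleR)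
  also have "\<dots> \<le> s * \<bar>r\<bar> + t * \<bar>r\<bar>" using x y st by (intro add_mono mult_left_mono)
  also have "\<dots> = \<bar>r\<bar>" using st(3) by (metis distrib_right mult_1)
  finally show "?P (s *\<^sub>R x + t *\<^sub>R y) \<le> \<bar>r\<bar>" .
qed

lemma compact_truncated_ellipsoid: "compact (truncated_ellipsoid vbar S r)"
proof -
  have cont: "continuous_on UNIV (\<lambda>v. cov_norm (matrix_inv S *v (v - vbar)))"
    by (intro continuous_on_cov_norm continuous_on_compose2[of UNIV "(*v) (matrix_inv S)" UNIV "\<lambda>v. v - vbar"]
        matrix_vector_mult_linear_continuous_on continuous_intros) auto
  have "closed {v. cov_norm (matrix_inv S *v (v - vbar)) \<le> \<bar>r\<bar>}"
    using continuous_closed_preimage[OF cont closed_UNIV, of "{..\<bar>r\<bar>}"] by (simp add: vimage_def)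
  moreover have "{v :: real^'k. 0 \<le> v} = (\<Inter>p. {v. 0 \<le> axis p 1 \<bullet> v})"
    by (auto simp: less_eq_vec_def inner_axis')
  then have "closed {v :: real^'k. 0 \<le> v}"
    by (auto intro!: closed_INT simp: closed_halfspace_ge)
  moreover have "truncated_ellipsoid vbar S r
      = {v. cov_norm (matrix_inv S *v (v - vbar)) \<le> \<bar>r\<bar>} \<inter> {v. 0 \<le> v}"
    by (auto simp: truncated_ellipsoid_def ellipsoid_form_le_iff)
  moreover have "bounded {v. cov_norm (matrix_inv S *v (v - vbar)) \<le> \<bar>r\<bar>}"
  proof -
    obtain K where K: "0 < K" "\<And>x. norm x \<le> K * cov_norm x" using norm_le_cov_norm by blast
    obtain L where L: "0 < L" "\<And>x. norm (S *v x) \<le> norm x * L"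
      using bounded_linear.pos_bounded[OF matrix_vector_mul_bounded_linear[of S]] by blast
    \<comment> \<open>\<open>v - vbar\<close> is the image under \<open>S\<close> of a vector whose
      \<open>cov_norm\<close> is at most \<open>\<bar>r\<bar>\<close>.\<close>
    have "norm v \<le> K * \<bar>r\<bar> * L + norm vbar"
      if v: "cov_norm (matrix_inv S *v (v - vbar)) \<le> \<bar>r\<bar>" for v
    proof -
      have "norm (v - vbar) = norm (S *v (matrix_inv S *v (v - vbar)))"
        by (simp add: matrix_inv_mult_vec[OF invertible])
      also have "\<dots> \<le> norm (matrix_inv S *v (v - vbar)) * L" by (rule L(2))
      also have "\<dots> \<le> (K * cov_norm (matrix_inv S *v (v - vbar))) * L"
        using K L by (intro mult_right_mono) auto
      also have "\<dots> \<le> (K * \<bar>r\<bar>) * L"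
        using v K L by (intro mult_right_mono mult_left_mono) auto
      finally show ?thesis using norm_triangle_sub[of v vbar] by linarith
    qed
    then show ?thesis by (auto intro: boundedI)
  qed
  ultimately show ?thesis by (simp add: compact_eq_bounded_closed closed_Int bounded_Int)
qed

lemma v0_in_truncated_ellipsoid: "v0 \<in> truncated_ellipsoid vbar S r"
  using v0_form v0_nonneg by (simp add: truncated_ellipsoid_def)

lemma inner_minimum_exists:
  "\<exists>v\<in>truncated_ellipsoid vbar S r. \<forall>y\<in>truncated_ellipsoid vbar S r. a \<bullet> v \<le> a \<bullet> y"
  using compact_truncated_ellipsoid v0_in_truncated_ellipsoid
  by (intro continuous_attains_inf) (auto intro!: continuous_intros)

lemma worst_value_le_inner_truncated:
  assumes "0 \<le> b" "v \<in> truncated_ellipsoid vbar S r"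
  shows "worst_value (a - b) \<le> a \<bullet> v"
proof -
  have "worst_value (a - b) \<le> (a - b) \<bullet> v"
    using assms by (intro worst_value_le_inner) (auto simp: truncated_ellipsoid_def)
  also have "\<dots> \<le> a \<bullet> v"
    using inner_nonneg_vec[of b v] assms by (simp add: truncated_ellipsoid_def inner_diff_left)
  finally show ?thesis .
qed

text \<open>Lagrange duality for the constraint \<open>0 \<le> v\<close>. The multiplier \<open>b\<close> is the normalized normal
  vector of a hyperplane separating the origin from the set of attainable (value, constraint slack)
  pairs; strict positivity of \<open>v0\<close> makes its value component nonzero.\<close>

lemma sign_multiplier_exists:
  assumes t: "\<And>v. v \<in> truncated_ellipsoid vbar S r \<Longrightarrow> t \<le> a \<bullet> v"
  shows "\<exists>b\<ge>0. t \<le> worst_value (a - b)"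
proof -
  define E where "E = {v. ellipsoid_form vbar S v \<le> r\<^sup>2}"
  \<comment> \<open>The strict inequality keeps the origin outside \<open>M\<close> even when
    \<open>t\<close> is attained. Upward closure in both components makes the components of the
    normal nonnegative.\<close>
  define M :: "(real \<times> (real^'k)) set" where "M = {(\<alpha>, y). \<exists>v\<in>E. a \<bullet> v - t < \<alpha> \<and> - v \<le> y}"
  have v0E: "v0 \<in> E" using v0_form by (simp add: E_def)
  have "convex M"
  proof (rule convexI)
    fix z z' :: "real \<times> (real^'k)" and s s' :: real
    assume z: "z \<in> M" "z' \<in> M" and s: "0 \<le> s" "0 \<le> s'" "s + s' = 1"
    obtain v where v: "v \<in> E" "a \<bullet> v - t < fst z" "- v \<le> snd z" using z(1) by (auto simp: M_def)
    obtain v' where v': "v' \<in> E" "a \<bullet> v' - t < fst z'" "- v' \<le> snd z'" using z(2) by (auto simp: M_def)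
    define u where "u = s *\<^sub>R v + s' *\<^sub>R v'"
    have "u \<in> E"
      using convexD[OF convex_ellipsoid, of v v' s s'] v(1) v'(1) s by (simp add: u_def E_def)
    moreover have "a \<bullet> u - t = s * (a \<bullet> v - t) + s' * (a \<bullet> v' - t)"
      using distrib_right[of s s' t] s(3) by (simp add: u_def inner_add_right right_diff_distrib)
    moreover have "s * (a \<bullet> v - t) + s' * (a \<bullet> v' - t) < s * fst z + s' * fst z'"
    \<comment> \<open>Strictness survives because at least one of the two weights is
      positive.\<close>
    proof (cases "s = 0")
      case True
      then show ?thesis using s v' by simp
    next
      case False
      then have "s * (a \<bullet> v - t) < s * fst z" using s v by simp
      moreover have "s' * (a \<bullet> v' - t) \<le> s' * fst z'" using s v' by (intro mult_left_mono) auto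
      ultimately show ?thesis by linarith
    qed
    moreover have "- u $ p \<le> (s *\<^sub>R snd z + s' *\<^sub>R snd z') $ p" for p
    proof -
      have "s * (- v $ p) + s' * (- v' $ p) \<le> s * snd z $ p + s' * snd z' $ p"
        using v(3) v'(3) s by (intro add_mono mult_left_mono) (auto simp: less_eq_vec_def)
      then show ?thesis by (simp add: u_def)
    qed
    ultimately show "s *\<^sub>R z + s' *\<^sub>R z' \<in> M"
      unfolding M_def less_eq_vec_def by (auto simp: case_prod_unfold intro!: bexI[of _ u])
  qed
  moreover have "0 \<notin> M"
  proof
    assume "0 \<in> M"
    then obtain v where "v \<in> E" "a \<bullet> v - t < 0" "- v \<le> 0" by (auto simp: M_def case_prod_unfold)
    then show False using t[of v] by (auto simp: E_def truncated_ellipsoid_def)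
  qed
  ultimately have "\<exists>n. n \<noteq> 0 \<and> (\<forall>z\<in>M. 0 \<le> n \<bullet> z)"
    by (rule separating_hyperplane_set_0)
  then obtain n where n: "n \<noteq> 0" "\<And>z. z \<in> M \<Longrightarrow> 0 \<le> n \<bullet> z" by auto
  define \<mu> \<beta> where "\<mu> = fst n" and "\<beta> = snd n"
  have sep: "0 \<le> \<mu> * \<alpha> + \<beta> \<bullet> y" if "v \<in> E" "a \<bullet> v - t < \<alpha>" "- v \<le> y" for v \<alpha> y
    using n(2)[of "(\<alpha>, y)"] that by (auto simp: M_def \<mu>_def \<beta>_def inner_prod_def)
  have \<mu>: "0 \<le> \<mu>"
  proof (rule affine_nonneg_imp_slope_nonneg)
    fix s :: real assume "0 \<le> s"
    then show "0 \<le> (\<mu> * (a \<bullet> v0 - t + 1) - \<beta> \<bullet> v0) + s * \<mu>"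
      using sep[OF v0E, of "a \<bullet> v0 - t + 1 + s" "- v0"] by (simp add: algebra_simps)
  qed
  have \<beta>: "0 \<le> \<beta> $ p" for p
  proof (rule affine_nonneg_imp_slope_nonneg)
    fix s :: real assume s: "0 \<le> s"
    then have "- v0 \<le> - v0 + s *\<^sub>R axis p 1" by (simp add: less_eq_vec_def axis_def)
    then show "0 \<le> (\<mu> * (a \<bullet> v0 - t + 1) - \<beta> \<bullet> v0) + s * \<beta> $ p"
      using sep[OF v0E, of "a \<bullet> v0 - t + 1" "- v0 + s *\<^sub>R axis p 1"]
      by (simp add: inner_add_right inner_diff_right inner_axis)
  qed
  have "\<mu> \<noteq> 0"
  proof
    assume 0: "\<mu> = 0"
    then have "\<beta> \<bullet> v0 \<le> 0" using sep[OF v0E, of "a \<bullet> v0 - t + 1" "- v0"] by simp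
    moreover have nn: "0 \<le> \<beta> $ p * v0 $ p" for p using \<beta> v0_pos by (simp add: less_imp_le)
    ultimately have "(\<Sum>p\<in>UNIV. \<beta> $ p * v0 $ p) = 0"
      by (intro antisym sum_nonneg) (auto simp: inner_vec_def)
    then have "\<beta> $ p * v0 $ p = 0" for p using nn by (simp add: sum_nonneg_eq_0_iff)
    then have "\<beta> $ p = 0" for p using v0_pos[of p] by (metis less_irrefl mult_eq_0_iff)
    then have "\<beta> = 0" by (simp add: vec_eq_iff)
    then show False using n(1) 0 by (simp add: \<mu>_def \<beta>_def prod_eq_iff)
  qed
  with \<mu> have \<mu>: "0 < \<mu>" by simp
  define b where "b = (1 / \<mu>) *\<^sub>R \<beta>"
  have "0 \<le> b" using \<beta> \<mu> by (simp add: b_def less_eq_vec_def)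
  \<comment> \<open>The bound holds on the full ellipsoid, the sign constraint having moved into
    \<open>b\<close>. The slack \<open>e\<close> pays for the strict inequality in
    \<open>M\<close>.\<close>
  moreover have "t \<le> (a - b) \<bullet> v" if v: "v \<in> E" for v
  proof (rule field_le_epsilon)
    fix e :: real assume "0 < e"
    then have "0 \<le> \<mu> * (a \<bullet> v - t + e) + \<beta> \<bullet> (- v)" by (intro sep[OF v]) auto
    then have "0 \<le> (\<mu> * (a \<bullet> v - t + e) + \<beta> \<bullet> (- v)) / \<mu>" using \<mu> by simp
    also have "\<dots> = a \<bullet> v - t + e - b \<bullet> v" using \<mu> by (simp add: b_def field_simps)
    finally show "t \<le> (a - b) \<bullet> v + e" by (simp add: inner_diff_left)
  qed
  moreover obtain v where "v \<in> E" "(a - b) \<bullet> v = worst_value (a - b)"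
    using worst_value_attained[of "a - b"] by (auto simp: E_def)
  ultimately show ?thesis by metis
qed

lemma robust_value_ge:
  "0 \<le> b \<Longrightarrow> ereal (worst_value (a - b)) \<le> (INF v\<in>truncated_ellipsoid vbar S r. ereal (a \<bullet> v))"
  by (intro INF_greatest) (simp add: worst_value_le_inner_truncated)

lemma robust_value_eq:
  "\<exists>b\<ge>0. (INF v\<in>truncated_ellipsoid vbar S r. ereal (a \<bullet> v)) = ereal (worst_value (a - b))"
proof -
  let ?V = "truncated_ellipsoid vbar S r"
  obtain v where v: "v \<in> ?V" "\<And>y. y \<in> ?V \<Longrightarrow> a \<bullet> v \<le> a \<bullet> y" using inner_minimum_exists by blast
  obtain b where b: "0 \<le> b" "a \<bullet> v \<le> worst_value (a - b)" using sign_multiplier_exists v(2) by blast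
  have "(INF v\<in>?V. ereal (a \<bullet> v)) \<le> ereal (worst_value (a - b))"
    using v(1) b(2) by (metis INF_lower order_trans ereal_less_eq(3))
  then show ?thesis using b(1) robust_value_ge[of b a] by (metis antisym)
qed

section \<open>Eliminating the ellipsoid multiplier\<close>

definition multiplier :: "real^'k \<Rightarrow> real" where
  "multiplier x = cov_norm x / (2 * \<bar>r\<bar>)"

lemma multiplier_nonneg: "0 \<le> multiplier x"
  by (simp add: multiplier_def)

lemma multiplier_pos_iff: "0 < multiplier x \<longleftrightarrow> x \<noteq> 0"
  using r_nonzero by (simp add: multiplier_def zero_less_divide_iff cov_norm_pos_iff)

lemma dual_objective_pos:
  "0 < l \<Longrightarrow> dual_objective vbar S r l x = ereal (x \<bullet> vbar - (cov_norm x)\<^sup>2 / (4 * l) - l * r\<^sup>2)"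
  by (simp add: dual_objective_def cov_norm_square)

lemma dual_objective_zero:
  "dual_objective vbar S r 0 x = (if x = 0 then 0 else - \<infinity>)"
proof -
  have "0 < x \<bullet> (S *v x)" if "x \<noteq> 0"
    using that by (simp add: cov_norm_square[symmetric] cov_norm_pos_iff)
  then show ?thesis by (cases "x = 0") (simp_all add: dual_objective_def zero_ereal_def)
qed

text \<open>Completing the square in the multiplier. This gap yields weak duality, the unique best
  multiplier, and later the ascent estimate for the iteration.\<close>

lemma worst_value_minus_dual:
  assumes "0 < l"
  shows "worst_value x - (x \<bullet> vbar - (cov_norm x)\<^sup>2 / (4 * l) - l * r\<^sup>2)
    = (cov_norm x - 2 * l * \<bar>r\<bar>)\<^sup>2 / (4 * l)"
proof -
  have "l * r\<^sup>2 = l * \<bar>r\<bar>\<^sup>2" by simp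
  then show ?thesis using assms
    unfolding worst_value_def by (simp add: field_simps power2_eq_square del: power2_abs)
qed

lemma dual_objective_le:
  assumes "0 \<le> l"
  shows "dual_objective vbar S r l x \<le> ereal (worst_value x)"
proof (cases "l = 0")
  case True
  then show ?thesis by (simp add: dual_objective_zero worst_value_def zero_ereal_def)
next
  case False
  then have l: "0 < l" using assms by simp
  then have "0 \<le> (cov_norm x - 2 * l * \<bar>r\<bar>)\<^sup>2 / (4 * l)" by simp
  then show ?thesis using worst_value_minus_dual[OF l, of x] by (simp add: dual_objective_pos[OF l])
qed

lemma dual_objective_eq_iff:
  assumes "0 \<le> l"
  shows "dual_objective vbar S r l x = ereal (worst_value x) \<longleftrightarrow> l = multiplier x"
proof (cases "l = 0")
  case True
  then show ?thesis
    using r_nonzero by (auto simp: dual_objective_zero worst_value_def zero_ereal_def multiplier_def)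
next
  case False
  then have l: "0 < l" using assms by simp
  have "dual_objective vbar S r l x = ereal (worst_value x)
      \<longleftrightarrow> (cov_norm x - 2 * l * \<bar>r\<bar>)\<^sup>2 / (4 * l) = 0"
    using worst_value_minus_dual[OF l, of x] by (auto simp: dual_objective_pos[OF l])
  also have "\<dots> \<longleftrightarrow> l = multiplier x" using l r_nonzero by (auto simp: multiplier_def field_simps)
  finally show ?thesis .
qed

lemma dual_objective_multiplier: "dual_objective vbar S r (multiplier x) x = ereal (worst_value x)"
  by (simp add: dual_objective_eq_iff multiplier_nonneg)

lemma concave_on_dual_objective:
  assumes "convex T" "0 < l"
  shows "concave_on T (\<lambda>x. x \<bullet> vbar - (x \<bullet> (S *v x)) / (4 * l) - l * r\<^sup>2)"
  unfolding concave_on_iff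
proof (intro conjI ballI allI impI assms(1))
  fix x y :: "real^'k" and u v :: real
  assume uv: "0 \<le> u" "0 \<le> v" "u + v = 1"
  let ?Q = "\<lambda>x. x \<bullet> (S *v x)"
  have v: "v = 1 - u" using uv(3) by simp
  \<comment> \<open>The convexity defect of a quadratic form is exactly \<open>u * v\<close> times
    the form of the difference.\<close>
  have "u * ?Q x + v * ?Q y - ?Q (u *\<^sub>R x + v *\<^sub>R y) = u * v * ?Q (x - y)"
    using quad_form_linear_combination[of 1 x "-1" y] unfolding quad_form_linear_combination v
    by (simp add: inner_S_commute[of y x] power2_eq_square algebra_simps)
  moreover have "0 \<le> u * v * ?Q (x - y)" using uv by (simp add: inner_S_nonneg)
  ultimately have "?Q (u *\<^sub>R x + v *\<^sub>R y) / (4 * l) \<le> (u * ?Q x + v * ?Q y) / (4 * l)"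
    using assms(2) by (intro divide_right_mono) auto
  moreover have "u * (l * r\<^sup>2) + v * (l * r\<^sup>2) = l * r\<^sup>2"
    using uv(3) by (metis distrib_right mult_1)
  ultimately show "u * (x \<bullet> vbar - ?Q x / (4 * l) - l * r\<^sup>2) + v * (y \<bullet> vbar - ?Q y / (4 * l) - l * r\<^sup>2)
      \<le> (u *\<^sub>R x + v *\<^sub>R y) \<bullet> vbar - ?Q (u *\<^sub>R x + v *\<^sub>R y) / (4 * l) - l * r\<^sup>2"
    by (simp add: inner_add_left right_diff_distrib add_divide_distrib)
qed

lemma multiplier_step_iff: "multiplier_step vbar S r x l \<longleftrightarrow> l = multiplier x"
proof
  assume "multiplier_step vbar S r x l"
  then have l: "0 \<le> l" "\<And>y. 0 \<le> y \<Longrightarrow> dual_objective vbar S r y x \<le> dual_objective vbar S r l x"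
    by (auto simp: multiplier_step_def is_arg_max_linorder)
  have "ereal (worst_value x) \<le> dual_objective vbar S r l x"
    using l(2)[OF multiplier_nonneg[of x]] by (simp add: dual_objective_multiplier)
  then show "l = multiplier x" using dual_objective_le[OF l(1), of x] dual_objective_eq_iff[OF l(1)] by force
next
  assume "l = multiplier x"
  then show "multiplier_step vbar S r x l"
    by (simp add: multiplier_step_def is_arg_max_linorder multiplier_nonneg dual_objective_multiplier dual_objective_le)
qed

text \<open>Partial maximization: at fixed \<open>x\<close> the best dual value is
  \<open>worst_value x\<close>, reached at \<open>multiplier x\<close> alone, so the joint problem
  is the maximization of \<open>worst_value\<close>.\<close>

lemma dual_optimal_iff:
  "dual_optimal \<Lambda> vbar S r l x \<longleftrightarrow>
    x \<in> \<Lambda> \<and> l = multiplier x \<and> (\<forall>y\<in>\<Lambda>. worst_value y \<le> worst_value x)"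
proof
  assume "dual_optimal \<Lambda> vbar S r l x"
  then have l: "0 \<le> l" and x: "x \<in> \<Lambda>"
    and opt: "\<And>l' y. 0 \<le> l' \<Longrightarrow> y \<in> \<Lambda> \<Longrightarrow> dual_objective vbar S r l' y \<le> dual_objective vbar S r l x"
    by (auto simp: dual_optimal_def is_arg_max_linorder)
  have *: "ereal (worst_value y) \<le> dual_objective vbar S r l x" if "y \<in> \<Lambda>" for y
    using opt[OF multiplier_nonneg that, of y] by (simp add: dual_objective_multiplier)
  then have eq: "dual_objective vbar S r l x = ereal (worst_value x)"
    using x dual_objective_le[OF l, of x] by (simp add: antisym)
  then show "x \<in> \<Lambda> \<and> l = multiplier x \<and> (\<forall>y\<in>\<Lambda>. worst_value y \<le> worst_value x)"
    using x *[unfolded eq] eq[unfolded dual_objective_eq_iff[OF l]] by simp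
next
  assume *: "x \<in> \<Lambda> \<and> l = multiplier x \<and> (\<forall>y\<in>\<Lambda>. worst_value y \<le> worst_value x)"
  then have "dual_objective vbar S r l' y \<le> dual_objective vbar S r l x" if "0 \<le> l'" "y \<in> \<Lambda>" for l' y
    using dual_objective_le[OF that(1), of y] that(2)
    by (simp add: dual_objective_multiplier) (metis ereal_less_eq(3) order_trans)
  with * show "dual_optimal \<Lambda> vbar S r l x"
    by (simp add: dual_optimal_def is_arg_max_linorder multiplier_nonneg)
qed

end

subsection \<open>Alternating maximization\<close>

text \<open>If \<open>x\<close> did not converge to its limit point \<open>z\<close>, some
  subsequence would keep a positive distance from \<open>z\<close>; by compactness it has a limit
  point, which uniqueness identifies with \<open>z\<close>.\<close>

lemma compact_unique_limit_point_convergent: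
  fixes x :: "nat \<Rightarrow> 'a::metric_space"
  assumes K: "compact K" "\<And>k. x k \<in> K"
    and unique: "\<And>f g y z. strict_mono f \<Longrightarrow> strict_mono g \<Longrightarrow> (x \<circ> f) \<longlonglongrightarrow> y \<Longrightarrow> (x \<circ> g) \<longlonglongrightarrow> z \<Longrightarrow> y = z"
  shows "\<exists>z. x \<longlonglongrightarrow> z"
proof -
  have sub: "\<exists>z f. strict_mono f \<and> (u \<circ> f) \<longlonglongrightarrow> z" if u: "\<And>k. u k \<in> K" for u :: "nat \<Rightarrow> 'a"
  proof -
    have "\<forall>k. u k \<in> K" using u by blast
    then show ?thesis using compact_imp_seq_compact[OF K(1)] by (blast elim: seq_compactE)
  qed
  obtain z f where f: "strict_mono f" "(x \<circ> f) \<longlonglongrightarrow> z" using sub K(2) by blast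
  have "x \<longlonglongrightarrow> z"
  proof (rule ccontr)
    assume "\<not> x \<longlonglongrightarrow> z"
    then obtain e where e: "0 < e" "\<forall>N. \<exists>k\<ge>N. e \<le> dist (x k) z"
      by (auto simp: lim_sequentially not_less)
    then have "infinite {k. e \<le> dist (x k) z}"
      by (simp add: infinite_nat_iff_unbounded_le)
    then obtain g :: "nat \<Rightarrow> nat" where g: "strict_mono g" "\<And>k. e \<le> dist (x (g k)) z"
      using infinite_enumerate by blast
    obtain z' h where h: "strict_mono h" "((x \<circ> g) \<circ> h) \<longlonglongrightarrow> z'"
      using sub[of "x \<circ> g"] K(2) by auto
    have "(x \<circ> (g \<circ> h)) \<longlonglongrightarrow> z'" using h(2) by (simp only: comp_assoc)
    then have "z' = z" by (rule unique[OF strict_mono_o[OF g(1) h(1)] f(1) _ f(2)])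
    with h(2) obtain N where "\<forall>n\<ge>N. dist (((x \<circ> g) \<circ> h) n) z < e"
      using metric_LIMSEQ_D[OF _ e(1)] by blast
    then have "dist (((x \<circ> g) \<circ> h) N) z < e" by simp
    then show False using g(2)[of "h N"] by simp
  qed
  then show ?thesis by blast
qed

text \<open>A downward closure is unbounded. The bound \<open>M\<close> on the inner product with
  the Slater point stands in for compactness.\<close>

locale concave_dual = slater_ellipsoid vbar S r v0
  for vbar :: "real^'k" and S r v0 +
  fixes \<Lambda> :: "(real^'k) set" and M :: real
  assumes closed: "closed \<Lambda>" and convex: "convex \<Lambda>" and zero: "0 \<in> \<Lambda>"
    and inner_v0_le: "\<And>x. x \<in> \<Lambda> \<Longrightarrow> x \<bullet> v0 \<le> M"
begin

lemma worst_value_zero [simp]: "worst_value 0 = 0"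
  by (simp add: worst_value_def)

lemma worst_value_scaleR: "0 \<le> t \<Longrightarrow> worst_value (t *\<^sub>R x) = t * worst_value x"
  by (simp add: worst_value_def cov_norm_scaleR right_diff_distrib)

lemma continuous_on_worst_value: "continuous_on T worst_value"
  unfolding worst_value_def by (intro continuous_intros)

text \<open>Apply \<open>inner_ellipsoid_ge\<close> at \<open>v0\<close>. Since \<open>v0\<close> is
  strictly inside the ellipsoid, \<open>s < \<bar>r\<bar>\<close>, and the difference is the
  coercivity constant.\<close>

lemma worst_value_coercive: "\<exists>\<epsilon>>0. \<forall>x\<in>\<Lambda>. \<epsilon> * cov_norm x \<le> M - worst_value x"
proof (intro exI conjI ballI)
  define s where "s = sqrt (ellipsoid_form vbar S v0)"
  show "0 < \<bar>r\<bar> - s" using real_sqrt_less_mono[OF v0_form] by (simp add: s_def)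
  show "(\<bar>r\<bar> - s) * cov_norm x \<le> M - worst_value x" if "x \<in> \<Lambda>" for x
    using inner_ellipsoid_ge[of x v0] inner_v0_le[OF that]
    by (simp add: worst_value_def s_def algebra_simps)
qed

lemma bounded_superlevel: "bounded {x \<in> \<Lambda>. c \<le> worst_value x}"
proof -
  obtain K where K: "0 < K" "\<And>x. norm x \<le> K * cov_norm x" using norm_le_cov_norm by blast
  obtain \<epsilon> where \<epsilon>: "0 < \<epsilon>" "\<And>x. x \<in> \<Lambda> \<Longrightarrow> \<epsilon> * cov_norm x \<le> M - worst_value x"
    using worst_value_coercive by blast
  have "norm x \<le> K * ((M - c) / \<epsilon>)" if "x \<in> \<Lambda>" "c \<le> worst_value x" for x
  proof -
    have "\<epsilon> * cov_norm x \<le> M - c" using \<epsilon>(2)[OF that(1)] that(2) by simp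
    then have "cov_norm x \<le> (M - c) / \<epsilon>" using \<epsilon>(1) by (simp add: field_simps)
    then show ?thesis using K by (meson mult_left_mono order_trans less_imp_le)
  qed
  then show ?thesis by (auto intro: boundedI)
qed

text \<open>The superlevel set of \<open>f\<close> at \<open>f 0\<close> lies in a superlevel set of
  \<open>worst_value\<close>, hence is compact. This serves both \<open>worst_value\<close> itself
  and the quadratic objective for fixed \<open>l > 0\<close>.\<close>

lemma maximum_exists:
  assumes cont: "continuous_on \<Lambda> f" and le: "\<And>x. x \<in> \<Lambda> \<Longrightarrow> f x \<le> worst_value x"
  shows "\<exists>x\<in>\<Lambda>. \<forall>y\<in>\<Lambda>. f y \<le> f x"
proof -
  define T where "T = {x \<in> \<Lambda>. f 0 \<le> f x}"
  have "T = \<Lambda> \<inter> f -` {f 0..}" by (auto simp: T_def)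
  then have "closed T" using continuous_closed_preimage[OF cont closed, of "{f 0..}"] by simp
  moreover have "T \<subseteq> {x \<in> \<Lambda>. f 0 \<le> worst_value x}" using le by (force simp: T_def)
  then have "bounded T" using bounded_superlevel bounded_subset by blast
  ultimately have "compact T" by (simp add: compact_eq_bounded_closed)
  moreover have "0 \<in> T" using zero by (simp add: T_def)
  moreover have "continuous_on T f" using cont by (rule continuous_on_subset) (auto simp: T_def)
  ultimately obtain x where "x \<in> T" "\<forall>y\<in>T. f y \<le> f x"
    using continuous_attains_sup[of T f] by blast
  then show ?thesis by (intro bexI[of _ x]) (force simp: T_def)+
qed

lemma worst_value_maximum_exists: "\<exists>x\<in>\<Lambda>. \<forall>y\<in>\<Lambda>. worst_value y \<le> worst_value x"
  using continuous_on_worst_value by (intro maximum_exists) auto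

lemma quadratic_step_exists:
  assumes "0 \<le> l"
  shows "\<exists>x. quadratic_step \<Lambda> vbar S r l x"
proof (cases "l = 0")
  case True
  then show ?thesis
    using zero by (intro exI[of _ 0]) (auto simp: quadratic_step_def is_arg_max_linorder dual_objective_zero)
next
  case False
  then have l: "0 < l" using assms by simp
  have "\<exists>x\<in>\<Lambda>. \<forall>y\<in>\<Lambda>. y \<bullet> vbar - (cov_norm y)\<^sup>2 / (4 * l) - l * r\<^sup>2
      \<le> x \<bullet> vbar - (cov_norm x)\<^sup>2 / (4 * l) - l * r\<^sup>2"
  proof (rule maximum_exists)
    show "continuous_on \<Lambda> (\<lambda>y. y \<bullet> vbar - (cov_norm y)\<^sup>2 / (4 * l) - l * r\<^sup>2)"
      using l by (intro continuous_intros) auto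
    show "x \<bullet> vbar - (cov_norm x)\<^sup>2 / (4 * l) - l * r\<^sup>2 \<le> worst_value x" for x
      using dual_objective_le[of l x] l by (simp add: dual_objective_pos)
  qed
  then show ?thesis using l
    by (auto simp: quadratic_step_def is_arg_max_linorder dual_objective_pos)
qed

section \<open>Inequalities for one round of the iteration\<close>

lemma quadratic_step_zero:
  assumes "quadratic_step \<Lambda> vbar S r 0 x"
  shows "x = 0"
proof (rule ccontr)
  assume "x \<noteq> 0"
  moreover have "dual_objective vbar S r 0 0 \<le> dual_objective vbar S r 0 x"
    using assms zero by (simp add: quadratic_step_def is_arg_max_linorder)
  ultimately show False by (simp add: dual_objective_zero)
qed

text \<open>The first-order condition without derivatives: compare \<open>y\<close> with the points
  \<open>y + t *\<^sub>R d\<close> of the segment towards \<open>x\<close>, divide by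
  \<open>t\<close>, and use small \<open>t\<close>.\<close>

lemma quadratic_step_variational:
  assumes l: "0 < l" and y: "quadratic_step \<Lambda> vbar S r l y" and x: "x \<in> \<Lambda>"
  shows "2 * l * ((x - y) \<bullet> vbar) \<le> (x - y) \<bullet> (S *v y)"
proof -
  define d where "d = x - y"
  define D where "D = d \<bullet> (S *v d)"
  define g where "g = 4 * l * (d \<bullet> vbar) - 2 * (d \<bullet> (S *v y))"
  have y\<Lambda>: "y \<in> \<Lambda>" and max: "\<And>z. z \<in> \<Lambda> \<Longrightarrow> z \<bullet> vbar - (z \<bullet> (S *v z)) / (4 * l) \<le> y \<bullet> vbar - (y \<bullet> (S *v y)) / (4 * l)"
    using y l by (auto simp: quadratic_step_def is_arg_max_linorder dual_objective_pos cov_norm_square)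
  have g: "g \<le> t * D" if t: "0 < t" "t \<le> 1" for t
  proof -
    have "(1 - t) *\<^sub>R y + t *\<^sub>R x = y + t *\<^sub>R d" by (simp add: d_def algebra_simps)
    then have "y + t *\<^sub>R d \<in> \<Lambda>"
      using convexD[OF convex y\<Lambda> x, of "1 - t" t] t by simp
    moreover have "(y + t *\<^sub>R d) \<bullet> (S *v (y + t *\<^sub>R d)) = y \<bullet> (S *v y) + 2 * t * (d \<bullet> (S *v y)) + t\<^sup>2 * D"
      using quad_form_linear_combination[of 1 y t d] by (simp add: D_def inner_S_commute[of y d])
    ultimately have "t * (d \<bullet> vbar) \<le> (2 * t * (d \<bullet> (S *v y)) + t\<^sup>2 * D) / (4 * l)"
      using max[of "y + t *\<^sub>R d"] by (simp add: inner_add_left add_divide_distrib)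
    then have "t * g \<le> t * (t * D)"
      using l by (simp add: g_def field_simps power2_eq_square)
    then show ?thesis using t by simp
  qed
  have "g \<le> 0"
  proof (rule ccontr)
    assume "\<not> g \<le> 0"
    moreover have "g \<le> D" using g[of 1] by simp
    ultimately have gD: "0 < g" "0 < D" "g \<le> D" by auto
    \<comment> \<open>The parameter \<open>g / (2 * D)\<close> is at most 1/2, hence admissible, and
      yields \<open>g \<le> g / 2\<close>.\<close>
    then have "g \<le> g / (2 * D) * D" by (intro g) (auto simp: field_simps)
    then show False using gD by simp
  qed
  then show ?thesis by (simp add: g_def d_def)
qed

text \<open>The variational inequality, with
  \<open>2 * multiplier x * \<bar>r\<bar> = cov_norm x\<close> and Cauchy-Schwarz for
  \<open>z \<bullet> (S *v y)\<close>. Optimality of \<open>y\<close> can fail only as far as the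
  norm changes in the step.\<close>

lemma alternating_step_bound:
  assumes x: "x \<noteq> 0" and y: "quadratic_step \<Lambda> vbar S r (multiplier x) y" and z: "z \<in> \<Lambda>"
  shows "cov_norm x * (worst_value z - worst_value y)
    \<le> \<bar>r\<bar> * ((cov_norm y - cov_norm x) * (cov_norm z - cov_norm y))"
proof -
  have "cov_norm x * ((z - y) \<bullet> vbar) = \<bar>r\<bar> * (2 * multiplier x * ((z - y) \<bullet> vbar))"
    using r_nonzero by (simp add: multiplier_def)
  also have "\<dots> \<le> \<bar>r\<bar> * ((z - y) \<bullet> (S *v y))"
    using quadratic_step_variational[OF _ y z] x by (intro mult_left_mono) (auto simp: multiplier_pos_iff)
  also have "(z - y) \<bullet> (S *v y) = z \<bullet> (S *v y) - (cov_norm y)\<^sup>2"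
    by (simp add: inner_diff_left cov_norm_square)
  also have "\<bar>r\<bar> * \<dots> \<le> \<bar>r\<bar> * (cov_norm z * cov_norm y - (cov_norm y)\<^sup>2)"
    using inner_S_le by (intro mult_left_mono) auto
  finally show ?thesis
    by (simp add: worst_value_def inner_diff_left power2_eq_square algebra_simps)
qed

text \<open>At the multiplier of \<open>x\<close> the gap of \<open>worst_value_minus_dual\<close>
  is 0 at \<open>x\<close> and a multiple of the squared norm change at \<open>y\<close>, while the
  dual objective at \<open>y\<close> is no smaller than at \<open>x\<close>.\<close>

lemma alternating_step_ascent:
  assumes x: "x \<in> \<Lambda>" "x \<noteq> 0" and y: "quadratic_step \<Lambda> vbar S r (multiplier x) y"
  shows "\<bar>r\<bar> * (cov_norm y - cov_norm x)\<^sup>2 \<le> 2 * cov_norm x * (worst_value y - worst_value x)"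
proof -
  define l where "l = multiplier x"
  have l: "0 < l" using x by (simp add: l_def multiplier_pos_iff)
  have lx: "2 * l * \<bar>r\<bar> = cov_norm x" using r_nonzero by (simp add: l_def multiplier_def)
  have "dual_objective vbar S r l x \<le> dual_objective vbar S r l y"
    using y x(1) by (simp add: quadratic_step_def is_arg_max_linorder l_def)
  then have "ereal (worst_value x) \<le> dual_objective vbar S r l y"
    by (simp add: l_def dual_objective_multiplier)
  then have "worst_value x \<le> y \<bullet> vbar - (cov_norm y)\<^sup>2 / (4 * l) - l * r\<^sup>2"
    using l by (simp add: dual_objective_pos)
  then have "(cov_norm y - cov_norm x)\<^sup>2 / (4 * l) \<le> worst_value y - worst_value x"
    using worst_value_minus_dual[OF l, of y] by (simp add: lx)
  then have "(cov_norm y - cov_norm x)\<^sup>2 \<le> 4 * l * (worst_value y - worst_value x)"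
    using l by (simp add: field_simps)
  then have "\<bar>r\<bar> * (cov_norm y - cov_norm x)\<^sup>2 \<le> \<bar>r\<bar> * (4 * l * (worst_value y - worst_value x))"
    by (intro mult_left_mono) auto
  also have "\<dots> = 2 * (2 * l * \<bar>r\<bar>) * (worst_value y - worst_value x)" by simp
  finally show ?thesis by (simp only: lx)
qed

text \<open>Midpoints of maximizers are maximizers, so equality holds in the triangle inequality for
  \<open>cov_norm\<close>, which forces maximizers to lie on a common ray.\<close>

lemma maximizers_collinear:
  assumes x: "x \<in> \<Lambda>" "\<And>z. z \<in> \<Lambda> \<Longrightarrow> worst_value z \<le> worst_value x"
    and y: "y \<in> \<Lambda>" "worst_value y = worst_value x"
  shows "cov_norm y *\<^sub>R x = cov_norm x *\<^sub>R y"
proof -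
  have "(1 / 2) *\<^sub>R x + (1 / 2) *\<^sub>R y \<in> \<Lambda>"
    using convexD[OF convex x(1) y(1), of "1 / 2" "1 / 2"] by simp
  then have "worst_value ((1 / 2) *\<^sub>R (x + y)) \<le> worst_value x"
    using x(2) by (simp add: scaleR_right_distrib)
  then have "worst_value (x + y) \<le> worst_value x + worst_value y"
    using y(2) by (simp add: worst_value_scaleR)
  then have "\<bar>r\<bar> * (cov_norm x + cov_norm y) \<le> \<bar>r\<bar> * cov_norm (x + y)"
    by (simp add: worst_value_def inner_add_left algebra_simps)
  then have "cov_norm x + cov_norm y \<le> cov_norm (x + y)" using r_nonzero by simp
  then have "(cov_norm x + cov_norm y)\<^sup>2 \<le> (cov_norm (x + y))\<^sup>2"
    by (intro power_mono) auto
  then have "cov_norm x * cov_norm y \<le> x \<bullet> (S *v y)"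
    using quad_form_linear_combination[of 1 x 1 y] by (simp add: cov_norm_square[symmetric] power2_sum)
  then have "(cov_norm (cov_norm y *\<^sub>R x - cov_norm x *\<^sub>R y))\<^sup>2 \<le> 0"
    unfolding cov_norm_diff_scaled_square by (intro mult_nonneg_nonpos) auto
  then show ?thesis by simp
qed

lemma alternating_limit:
  assumes run: "alternating_run \<Lambda> vbar S r l x" and x0: "x 0 \<noteq> 0"
  shows "\<exists>xs. x \<longlonglongrightarrow> xs \<and> xs \<in> \<Lambda> \<and> (\<forall>y\<in>\<Lambda>. worst_value y \<le> worst_value xs)"
proof -
  have l: "l k = multiplier (x k)" for k
    using run by (simp add: alternating_run_def multiplier_step_iff)
  have step: "quadratic_step \<Lambda> vbar S r (multiplier (x k)) (x (Suc k))" for k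
    using run by (simp add: alternating_run_def flip: l)
  have x\<Lambda>: "x k \<in> \<Lambda>" for k
    using run by (cases k) (auto simp: alternating_run_def quadratic_step_def is_arg_max_linorder)
  let ?q = "\<lambda>k. cov_norm (x k)"
  have bound: "?q k * (worst_value z - worst_value (x (Suc k)))
      \<le> \<bar>r\<bar> * ((?q (Suc k) - ?q k) * (cov_norm z - ?q (Suc k)))" if "x k \<noteq> 0" "z \<in> \<Lambda>" for k z
    using alternating_step_bound step that by blast
  show ?thesis
  proof (cases "\<exists>k. x k = 0")
    case True
    \<comment> \<open>The predecessor of the first zero is nonzero, and \<open>bound\<close> there,
      with new norm 0, shows that \<open>worst_value\<close> is nowhere positive on
      \<open>\<Lambda>\<close>.\<close>
    define k where "k = (LEAST k. x k = 0)"
    have k: "x k = 0" unfolding k_def using True by (rule LeastI_ex)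
    then obtain j where j: "k = Suc j" using x0 by (cases k) auto
    have xj: "x j \<noteq> 0" using not_less_Least[of j "\<lambda>k. x k = 0"] j by (simp add: k_def)
    have "worst_value y \<le> worst_value 0" if "y \<in> \<Lambda>" for y
    proof -
      have "?q j * worst_value y \<le> \<bar>r\<bar> * (- ?q j * cov_norm y)"
        using bound[OF xj that] k j by simp
      also have "\<dots> \<le> 0" by (simp add: mult_nonneg_nonpos)
      finally show ?thesis using xj cov_norm_pos_iff[of "x j"] by (simp add: mult_le_0_iff)
    qed
    \<comment> \<open>Zero is absorbing: for the multiplier 0 every nonzero point has dual value
      \<open>-\<infinity>\<close>.\<close>
    moreover have "x (n + k) = 0" for n
    proof (induction n)
      case (Suc n)
      then have "quadratic_step \<Lambda> vbar S r 0 (x (Suc (n + k)))"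
        using step[of "n + k"] by (simp add: multiplier_def)
      then show ?case using quadratic_step_zero by simp
    qed (simp add: k)
    then have "x \<longlonglongrightarrow> 0" by (intro LIMSEQ_offset[of x k]) simp
    ultimately show ?thesis using zero by blast
  next
    case False
    then have nz: "x k \<noteq> 0" for k by blast
    have qpos: "0 < ?q k" for k using nz by (simp add: cov_norm_pos_iff)
    let ?w = "\<lambda>k. worst_value (x k)"
    have ascent: "\<bar>r\<bar> * (?q (Suc k) - ?q k)\<^sup>2 \<le> 2 * ?q k * (?w (Suc k) - ?w k)" for k
      using alternating_step_ascent[OF x\<Lambda> nz step] .
    have "?w k \<le> ?w (Suc k)" for k
    proof -
      have "0 \<le> \<bar>r\<bar> * (?q (Suc k) - ?q k)\<^sup>2" by simp
      then have "0 \<le> 2 * ?q k * (?w (Suc k) - ?w k)" using ascent by (rule order_trans)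
      then show ?thesis using qpos[of k] by (simp add: zero_le_mult_iff)
    qed
    then have inc: "incseq ?w" by (rule incseq_SucI)
    obtain m where m: "\<And>y. y \<in> \<Lambda> \<Longrightarrow> worst_value y \<le> worst_value m"
      using worst_value_maximum_exists by blast
    have "\<forall>k. ?w k \<le> worst_value m" using m x\<Lambda> by simp
    then obtain h where h: "?w \<longlonglongrightarrow> h" and "\<forall>k. ?w k \<le> h"
      by (rule incseq_convergent[OF inc])
    then have wh: "?w k \<le> h" for k by simp
    obtain \<epsilon> where \<epsilon>: "0 < \<epsilon>" "\<And>x. x \<in> \<Lambda> \<Longrightarrow> \<epsilon> * cov_norm x \<le> M - worst_value x"
      using worst_value_coercive by blast
    define Q where "Q = (M - ?w 0) / \<epsilon>"
    have qQ: "?q k \<le> Q" for k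
    proof -
      have "\<epsilon> * ?q k \<le> M - ?w 0" using \<epsilon>(2)[OF x\<Lambda>, of k] incseqD[OF inc, of 0 k] by simp
      then show ?thesis using \<epsilon>(1) by (simp add: Q_def field_simps)
    qed
    have opt: "worst_value y \<le> h" if y: "y \<in> \<Lambda>" for y
    proof (cases "\<exists>c>0. \<forall>k. c \<le> ?q k")
      case True
      then obtain c where c: "0 < c" "\<And>k. c \<le> ?q k" by blast
      \<comment> \<open>The squared norm changes will be dominated by increments of the convergent
        values.\<close>
      have "(\<lambda>k. 2 * Q / \<bar>r\<bar> * (?w (Suc k) - ?w k)) \<longlonglongrightarrow> 2 * Q / \<bar>r\<bar> * (h - h)"
        using LIMSEQ_Suc[OF h] h by (intro tendsto_mult tendsto_const tendsto_diff)
      then have lim: "(\<lambda>k. 2 * Q / \<bar>r\<bar> * (?w (Suc k) - ?w k)) \<longlonglongrightarrow> 0" by simp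
      have "norm ((?q (Suc k) - ?q k)\<^sup>2) \<le> 2 * Q / \<bar>r\<bar> * (?w (Suc k) - ?w k)" for k
      proof -
        have "2 * ?q k * (?w (Suc k) - ?w k) \<le> 2 * Q * (?w (Suc k) - ?w k)"
          using qQ[of k] incseq_SucD[OF inc, of k] by (intro mult_right_mono) simp_all
        then have "\<bar>r\<bar> * (?q (Suc k) - ?q k)\<^sup>2 \<le> 2 * Q * (?w (Suc k) - ?w k)"
          using ascent[of k] by linarith
        then show ?thesis using r_nonzero by (simp add: field_simps)
      qed
      then have "(\<lambda>k. (?q (Suc k) - ?q k)\<^sup>2) \<longlonglongrightarrow> 0"
        by (intro Lim_null_comparison[OF always_eventually lim] allI)
      then have diff: "(\<lambda>k. \<bar>?q (Suc k) - ?q k\<bar>) \<longlonglongrightarrow> 0"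
        using tendsto_real_sqrt[of "\<lambda>k. (?q (Suc k) - ?q k)\<^sup>2" 0 sequentially] by simp
      \<comment> \<open>The constant comes from dividing \<open>bound\<close> by \<open>c\<close>,
        with \<open>cov_norm y + Q\<close> bounding the last factor.\<close>
      define C where "C = \<bar>r\<bar> * (cov_norm y + Q) / c"
      have "(\<lambda>k. h + C * \<bar>?q (Suc k) - ?q k\<bar>) \<longlonglongrightarrow> h + C * 0"
        using diff by (intro tendsto_intros)
      moreover have "worst_value y \<le> h + C * \<bar>?q (Suc k) - ?q k\<bar>" for k
      proof (cases "worst_value y \<le> ?w (Suc k)")
        case True
        have "0 \<le> C" using c(1) qpos[of 0] qQ[of 0] by (auto simp: C_def)
        then have "0 \<le> C * \<bar>?q (Suc k) - ?q k\<bar>" by simp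
        with True show ?thesis using wh[of "Suc k"] by linarith
      next
        case False
        then have "c * (worst_value y - ?w (Suc k)) \<le> ?q k * (worst_value y - ?w (Suc k))"
          using c(2) by (intro mult_right_mono) auto
        also have "\<dots> \<le> \<bar>r\<bar> * ((?q (Suc k) - ?q k) * (cov_norm y - ?q (Suc k)))"
          by (rule bound[OF nz y])
        also have "\<dots> \<le> \<bar>r\<bar> * (\<bar>?q (Suc k) - ?q k\<bar> * (cov_norm y + Q))"
        proof (intro mult_left_mono)
          have "(?q (Suc k) - ?q k) * (cov_norm y - ?q (Suc k))
              \<le> \<bar>?q (Suc k) - ?q k\<bar> * \<bar>cov_norm y - ?q (Suc k)\<bar>"
            by (metis abs_ge_self abs_mult)
          also have "\<dots> \<le> \<bar>?q (Suc k) - ?q k\<bar> * (cov_norm y + Q)"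
          proof (intro mult_left_mono)
            show "\<bar>cov_norm y - ?q (Suc k)\<bar> \<le> cov_norm y + Q"
              using qQ[of "Suc k"] qpos[of "Suc k"] cov_norm_nonneg[of y] by linarith
          qed simp
          finally show "(?q (Suc k) - ?q k) * (cov_norm y - ?q (Suc k))
              \<le> \<bar>?q (Suc k) - ?q k\<bar> * (cov_norm y + Q)" .
        qed simp
        finally have "worst_value y - ?w (Suc k) \<le> C * \<bar>?q (Suc k) - ?q k\<bar>"
          using c(1) by (simp add: C_def field_simps)
        then show ?thesis using wh[of "Suc k"] by linarith
      qed
      ultimately show ?thesis by (intro LIMSEQ_le_const) auto
    next
      case False
      show ?thesis
      proof (rule field_le_epsilon)
        fix e :: real assume e: "0 < e"
        \<comment> \<open>The first argument makes the final error at most \<open>e\<close>; the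
          second excludes index 0. At the first index below \<open>c\<close> the norm has dropped in
          the preceding step.\<close>
        define c where "c = min (e / \<bar>r\<bar>) (?q 0)"
        define k where "k = (LEAST k. ?q k < c)"
        have "0 < c" using e qpos[of 0] r_nonzero by (simp add: c_def)
        then have "\<exists>k. ?q k < c" using False by (metis not_le)
        then have k: "?q k < c" unfolding k_def by (rule LeastI_ex)
        then obtain j where j: "k = Suc j" by (cases k) (auto simp: c_def)
        have "\<not> ?q j < c" using not_less_Least[of j "\<lambda>k. ?q k < c"] j by (simp add: k_def)
        then have q: "?q (Suc j) \<le> ?q j" using k j by simp
        have re: "\<bar>r\<bar> * ?q (Suc j) \<le> e"
          using k j r_nonzero by (simp add: c_def field_simps)
        have "?q j * (worst_value y - ?w (Suc j)) \<le> \<bar>r\<bar> * ((?q (Suc j) - ?q j) * (cov_norm y - ?q (Suc j)))"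
          by (rule bound[OF nz y])
        \<comment> \<open>As the norm drops, the contribution of \<open>cov_norm y\<close> is
          nonpositive, so the bound is independent of \<open>y\<close>.\<close>
        also have "(?q (Suc j) - ?q j) * (cov_norm y - ?q (Suc j)) \<le> ?q j * ?q (Suc j)"
        proof -
          have "0 \<le> (?q j - ?q (Suc j)) * cov_norm y" using q by simp
          then show ?thesis by (simp add: algebra_simps add_increasing2)
        qed
        then have "\<bar>r\<bar> * ((?q (Suc j) - ?q j) * (cov_norm y - ?q (Suc j))) \<le> \<bar>r\<bar> * (?q j * ?q (Suc j))"
          by (intro mult_left_mono) auto
        also have "\<dots> = ?q j * (\<bar>r\<bar> * ?q (Suc j))" by simp
        finally have "worst_value y - ?w (Suc j) \<le> \<bar>r\<bar> * ?q (Suc j)"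
          using qpos[of j] by simp
        then show "worst_value y \<le> h + e" using re wh[of "Suc j"] by linarith
      qed
    qed
    have limit_point: "z \<in> \<Lambda> \<and> worst_value z = h \<and> (\<lambda>k. ?q (f k)) \<longlonglongrightarrow> cov_norm z"
      if f: "strict_mono f" "(x \<circ> f) \<longlonglongrightarrow> z" for f z
    proof (intro conjI)
      show "z \<in> \<Lambda>" using x\<Lambda> by (intro closed_sequentially[OF closed _ f(2)]) simp
      have cont: "(\<lambda>k. g (x (f k))) \<longlonglongrightarrow> g z" if "continuous_on UNIV g" for g :: "real^'k \<Rightarrow> real"
        using continuous_on_tendsto_compose[OF that f(2)] by simp
      show "(\<lambda>k. ?q (f k)) \<longlonglongrightarrow> cov_norm z"
        by (intro cont continuous_on_cov_norm continuous_on_id)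
      have "(\<lambda>k. ?w (f k)) \<longlonglongrightarrow> h" using LIMSEQ_subseq_LIMSEQ[OF h f(1)] by (simp add: o_def)
      then show "worst_value z = h"
        using cont[OF continuous_on_worst_value] by (rule LIMSEQ_unique[rotated])
    qed
    have "\<exists>z. x \<longlonglongrightarrow> z"
    proof (rule compact_unique_limit_point_convergent)
      \<comment> \<open>The run never leaves the superlevel set of its initial value, which
        coercivity makes compact.\<close>
      let ?K = "{y \<in> \<Lambda>. ?w 0 \<le> worst_value y}"
      have "?K = \<Lambda> \<inter> worst_value -` {?w 0..}" by auto
      then have "closed ?K"
        using continuous_closed_preimage[OF continuous_on_worst_value closed, of "{?w 0..}"] by simp
      then show "compact ?K" using bounded_superlevel by (simp add: compact_eq_bounded_closed)
      show "x k \<in> ?K" for k using x\<Lambda> incseqD[OF inc, of 0 k] by simp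
      fix f g y z
      assume f: "strict_mono f" "(x \<circ> f) \<longlonglongrightarrow> y" and g: "strict_mono g" "(x \<circ> g) \<longlonglongrightarrow> z"
      note y = limit_point[OF f] and z = limit_point[OF g]
      have col: "cov_norm z *\<^sub>R y = cov_norm y *\<^sub>R z"
        using y z by (intro maximizers_collinear) (simp_all add: opt)
      have q_eq: "cov_norm y = cov_norm z"
      proof (cases "h = 0")
        case False
        have "worst_value (cov_norm z *\<^sub>R y) = worst_value (cov_norm y *\<^sub>R z)" by (simp only: col)
        then show ?thesis using y z False by (simp add: worst_value_scaleR)
      next
        case True
        have "decseq ?q"
        proof (rule decseq_SucI)
          fix k
          \<comment> \<open>With maximum 0 the origin is itself a maximizer, and as competitor in
            \<open>bound\<close> it forces the norms to decrease.\<close>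
          have "0 \<le> ?q k * (worst_value 0 - ?w (Suc k))"
            using wh[of "Suc k"] True qpos[of k] by (simp add: mult_nonneg_nonpos)
          also have "\<dots> \<le> \<bar>r\<bar> * ((?q (Suc k) - ?q k) * (cov_norm 0 - ?q (Suc k)))"
            by (rule bound[OF nz zero])
          finally have "0 \<le> \<bar>r\<bar> * ((?q (Suc k) - ?q k) * - ?q (Suc k))" by simp
          then show "?q (Suc k) \<le> ?q k"
            using qpos[of "Suc k"] r_nonzero by (auto simp: zero_le_mult_iff mult_le_0_iff)
        qed
        then obtain q where q: "?q \<longlonglongrightarrow> q"
          using decseq_convergent[of ?q 0] by auto
        have qf: "(\<lambda>k. ?q (f k)) \<longlonglongrightarrow> q" and qg: "(\<lambda>k. ?q (g k)) \<longlonglongrightarrow> q"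
          using LIMSEQ_subseq_LIMSEQ[OF q f(1)] LIMSEQ_subseq_LIMSEQ[OF q g(1)] by (simp_all add: o_def)
        have "q = cov_norm y" using LIMSEQ_unique[OF qf] y by simp
        moreover have "q = cov_norm z" using LIMSEQ_unique[OF qg] z by simp
        ultimately show ?thesis by simp
      qed
      show "y = z"
      proof (cases "z = 0")
        case True
        then show ?thesis using q_eq by simp
      next
        case False
        have "cov_norm z *\<^sub>R y = cov_norm z *\<^sub>R z" using col by (simp only: q_eq)
        then show ?thesis using False by simp
      qed
    qed
    then obtain z where z: "x \<longlonglongrightarrow> z" by blast
    then have "z \<in> \<Lambda>" "worst_value z = h"
      using limit_point[of id z] by (simp_all add: strict_mono_id)
    then show ?thesis using z opt by blast
  qed
qed

theorem alternating_converges: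
  assumes run: "alternating_run \<Lambda> vbar S r l x" and "x 0 \<noteq> 0"
  shows "\<exists>ls xs. l \<longlonglongrightarrow> ls \<and> x \<longlonglongrightarrow> xs \<and> dual_optimal \<Lambda> vbar S r ls xs"
proof -
  obtain xs where xs: "x \<longlonglongrightarrow> xs" "xs \<in> \<Lambda>" "\<forall>y\<in>\<Lambda>. worst_value y \<le> worst_value xs"
    using alternating_limit[OF assms] by blast
  have "l = (\<lambda>k. multiplier (x k))"
    using run by (intro ext) (simp add: alternating_run_def multiplier_step_iff)
  moreover have "continuous_on UNIV multiplier"
    unfolding multiplier_def using r_nonzero by (intro continuous_intros) auto
  then have "(\<lambda>k. multiplier (x k)) \<longlonglongrightarrow> multiplier xs"
    using continuous_on_tendsto_compose[OF _ xs(1), of UNIV multiplier] by simp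
  moreover have "dual_optimal \<Lambda> vbar S r (multiplier xs) xs"
    using xs by (simp add: dual_optimal_iff)
  ultimately show ?thesis using xs(1) by metis
qed

end

subsection \<open>The robust welfare problem\<close>

text \<open>Groups are nonempty, so each weight cancels the normalization by \<open>card G\<close>;
  exchanging the sums then meets every entry exactly once, in the group of its agent.\<close>

lemma welfare_eq_inner:
  fixes a v :: "real^('n::finite \<times> 'm::finite)"
  assumes groups: "partition_on UNIV \<G>" and weights: "\<And>G. G \<in> \<G> \<Longrightarrow> w G = real (card G)"
  shows "welfare \<G> w a v = a \<bullet> v"
proof -
  have fin: "finite \<G>" by simp
  have "w G * group_utility G a v = (\<Sum>p\<in>UNIV. if fst p \<in> G then a $ p * v $ p else 0)" if G: "G \<in> \<G>" for G
  proof -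
    have "G \<noteq> {}" using groups G by (metis partition_onD3)
    then have "w G * group_utility G a v = group_restrict G a \<bullet> group_restrict G v"
      using weights[OF G] by (simp add: group_utility_def)
    also have "\<dots> = (\<Sum>p\<in>UNIV. if fst p \<in> G then a $ p * v $ p else 0)"
      unfolding inner_vec_def group_restrict_def by (intro sum.cong) auto
    finally show ?thesis .
  qed
  then have "welfare \<G> w a v = (\<Sum>G\<in>\<G>. \<Sum>p\<in>UNIV. if fst p \<in> G then a $ p * v $ p else 0)"
    by (simp add: welfare_def)
  also have "\<dots> = (\<Sum>p\<in>UNIV. \<Sum>G\<in>\<G>. if fst p \<in> G then a $ p * v $ p else 0)"
    by (rule sum.swap)
  also have "\<dots> = (\<Sum>p\<in>UNIV. a $ p * v $ p)"
  proof (rule sum.cong[OF refl])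
    fix p :: "'n \<times> 'm"
    obtain G0 where G0: "G0 \<in> \<G>" "fst p \<in> G0" using partition_onD1[OF groups] by blast
    have "fst p \<in> G \<longleftrightarrow> G = G0" if "G \<in> \<G>" for G
      using that G0 partition_onD2[OF groups] by (auto dest: disjointD)
    then have "(\<Sum>G\<in>\<G>. if fst p \<in> G then a $ p * v $ p else 0) = (\<Sum>G\<in>\<G>. if G = G0 then a $ p * v $ p else 0)"
      by (intro sum.cong) auto
    then show "(\<Sum>G\<in>\<G>. if fst p \<in> G then a $ p * v $ p else 0) = a $ p * v $ p"
      using G0(1) fin by simp
  qed
  finally show ?thesis by (simp add: inner_vec_def)
qed

lemma group_restrict_le_iff:
  fixes x y :: "real^('n::finite \<times> 'm::finite)"
  assumes "partition_on UNIV \<G>"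
  shows "(\<forall>G\<in>\<G>. group_restrict G x \<le> group_restrict G y) \<longleftrightarrow> x \<le> y"
proof
  assume le: "\<forall>G\<in>\<G>. group_restrict G x \<le> group_restrict G y"
  have "x $ p \<le> y $ p" for p
  proof -
    obtain G where G: "G \<in> \<G>" "fst p \<in> G" using partition_onD1[OF assms] by blast
    have "group_restrict G x $ p \<le> group_restrict G y $ p"
      using le G(1) unfolding less_eq_vec_def by blast
    then show ?thesis using G(2) by (simp add: group_restrict_def)
  qed
  then show "x \<le> y" by (simp add: less_eq_vec_def)
qed (simp add: less_eq_vec_def group_restrict_def)

lemma downward_closure_iff: "x \<in> downward_closure A \<longleftrightarrow> (\<exists>a\<in>A. x \<le> a)"
proof
  assume "\<exists>a\<in>A. x \<le> a"
  then obtain a where "a \<in> A" "x = a - (a - x)" "0 \<le> a - x" by auto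
  then show "x \<in> downward_closure A" unfolding downward_closure_def by blast
qed (auto simp: downward_closure_def diff_le_eq intro!: bexI[rotated])

text \<open>\<open>M\<close> bounds a linear function on the compact set \<open>A\<close>;
  subtracting a nonnegative vector cannot increase the inner product with \<open>v0\<close>.\<close>

lemma concave_dual_downward_closure:
  assumes "slater_ellipsoid vbar S r v0" "polytope A" "A \<noteq> {}" "\<And>a. a \<in> A \<Longrightarrow> 0 \<le> a"
  shows "\<exists>M. concave_dual vbar S r v0 (downward_closure A) M"
proof -
  interpret slater_ellipsoid vbar S r v0 by fact
  have "compact ((\<lambda>a. a \<bullet> v0) ` A)"
    using assms(2) by (intro compact_continuous_image polytope_imp_compact continuous_intros)
  then obtain M where M: "\<And>a. a \<in> A \<Longrightarrow> a \<bullet> v0 \<le> M"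
    using compact_imp_bounded bounded_imp_bdd_above unfolding bdd_above_def by (metis imageI)
  have "x \<bullet> v0 \<le> M" if x: "x \<in> downward_closure A" for x
  proof -
    obtain a b where "a \<in> A" "0 \<le> b" "x = a - b" using x by (auto simp: downward_closure_def)
    then show ?thesis
      using M[of a] inner_nonneg_vec[OF _ v0_nonneg, of b] by (simp add: inner_diff_left)
  qed
  moreover have "0 \<in> downward_closure A" using assms(3,4) by (auto simp: downward_closure_iff)
  moreover note polyhedron_downward_closure[OF assms(2)]
  ultimately have "concave_dual vbar S r v0 (downward_closure A) M"
    by unfold_locales (auto simp: polyhedron_imp_closed polyhedron_imp_convex)
  then show ?thesis by blast
qed

section \<open>Correspondence of robust and dual optima\<close>

context slater_ellipsoid
begin

abbreviation (input) robust_value :: "real^'k \<Rightarrow> ereal" where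
  "robust_value a \<equiv> INF v\<in>truncated_ellipsoid vbar S r. ereal (a \<bullet> v)"

lemma worst_value_le_robust_value:
  assumes "x \<le> a"
  shows "ereal (worst_value x) \<le> robust_value a"
  using robust_value_ge[of "a - x" a] assms by simp

lemma robust_value_attained_below: "\<exists>x\<le>a. robust_value a = ereal (worst_value x)"
proof -
  obtain b where "0 \<le> b" "robust_value a = ereal (worst_value (a - b))" using robust_value_eq by blast
  then show ?thesis by (intro exI[of _ "a - b"]) simp
qed

text \<open>Dominating \<open>x\<close> guarantees a robust value of at least
  \<open>worst_value x\<close>, and the robust value of any competitor equals
  \<open>worst_value z\<close> for some \<open>z\<close> in the downward closure.\<close>

lemma robust_optimal_above_dual_optimal:
  assumes opt: "dual_optimal (downward_closure A) vbar S r l x" and a: "a \<in> A" "x \<le> a"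
  shows "robust_optimal A (truncated_ellipsoid vbar S r) (\<bullet>) a"
  unfolding robust_optimal_def is_arg_max_linorder
proof (intro conjI allI impI a)
  fix y assume "y \<in> A"
  obtain z where z: "z \<le> y" "robust_value y = ereal (worst_value z)"
    using robust_value_attained_below by blast
  then have "worst_value z \<le> worst_value x"
    using opt \<open>y \<in> A\<close> by (auto simp: dual_optimal_iff downward_closure_iff)
  then show "robust_value y \<le> robust_value a"
    using worst_value_le_robust_value[OF a(2)] z(2) by (metis ereal_less_eq(3) order_trans)
qed

text \<open>The witness is \<open>a\<close> minus its multiplier for the sign constraint, where
  \<open>worst_value\<close> equals the robust value of \<open>a\<close>.\<close>

lemma dual_optimal_below_robust_optimal:
  assumes opt: "robust_optimal A (truncated_ellipsoid vbar S r) (\<bullet>) a"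
  shows "\<exists>l x. dual_optimal (downward_closure A) vbar S r l x \<and> x \<le> a"
proof -
  have a: "a \<in> A" and max: "\<And>y. y \<in> A \<Longrightarrow> robust_value y \<le> robust_value a"
    using opt by (auto simp: robust_optimal_def is_arg_max_linorder)
  obtain x where x: "x \<le> a" "robust_value a = ereal (worst_value x)"
    using robust_value_attained_below by blast
  have "worst_value z \<le> worst_value x" if z: "z \<in> downward_closure A" for z
  proof -
    obtain y where y: "y \<in> A" "z \<le> y" using z by (auto simp: downward_closure_iff)
    have "ereal (worst_value z) \<le> ereal (worst_value x)"
      using worst_value_le_robust_value[OF y(2)] max[OF y(1)] unfolding x(2) by (rule order_trans)
    then show ?thesis by simp
  qed
  then have "dual_optimal (downward_closure A) vbar S r (multiplier x) x"
    using a x(1) by (auto simp: dual_optimal_iff downward_closure_iff)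
  then show ?thesis using x(1) by blast
qed

lemma robust_value_eq_dual_value:
  "(SUP a\<in>A. robust_value a) = (SUP (l, x)\<in>{0..} \<times> downward_closure A. dual_objective vbar S r l x)"
proof (rule antisym)
  show "(SUP a\<in>A. robust_value a) \<le> (SUP (l, x)\<in>{0..} \<times> downward_closure A. dual_objective vbar S r l x)"
  proof (rule SUP_least)
    fix a assume "a \<in> A"
    obtain x where x: "x \<le> a" "robust_value a = ereal (worst_value x)"
      using robust_value_attained_below by blast
    then have "(multiplier x, x) \<in> {0..} \<times> downward_closure A"
      using \<open>a \<in> A\<close> by (auto simp: downward_closure_iff multiplier_nonneg)
    from SUP_upper[OF this, of "\<lambda>(l, x). dual_objective vbar S r l x"]
    show "robust_value a \<le> (SUP (l, x)\<in>{0..} \<times> downward_closure A. dual_objective vbar S r l x)"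
      unfolding x(2) by (simp add: dual_objective_multiplier)
  qed
  show "(SUP (l, x)\<in>{0..} \<times> downward_closure A. dual_objective vbar S r l x) \<le> (SUP a\<in>A. robust_value a)"
  proof (rule SUP_least)
    fix p :: "real \<times> (real^'k)" assume "p \<in> {0..} \<times> downward_closure A"
    then obtain l x a where p: "p = (l, x)" and l: "0 \<le> l" and a: "a \<in> A" "x \<le> a"
      by (auto simp: downward_closure_iff)
    have "dual_objective vbar S r l x \<le> ereal (worst_value x)" using l by (rule dual_objective_le)
    also have "\<dots> \<le> robust_value a" by (rule worst_value_le_robust_value[OF a(2)])
    also have "\<dots> \<le> (SUP a\<in>A. robust_value a)" by (rule SUP_upper[OF a(1)])
    finally show "(case p of (l, x) \<Rightarrow> dual_objective vbar S r l x) \<le> (SUP a\<in>A. robust_value a)"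
      by (simp add: p)
  qed
qed

end

theorem corollary3p3:
  fixes \<G> :: "'n::finite set set" and w :: "'n set \<Rightarrow> real"
    and \<kappa>l \<kappa>u :: "real^'n" and \<psi>l \<psi>u :: "real^'m::finite" and c :: "real^('n \<times> 'm)"
    and vbar :: "real^('n \<times> 'm)" and S :: "real^('n \<times> 'm)^('n \<times> 'm)" and r :: real
    and A V \<Lambda> :: "(real^('n \<times> 'm)) set"
  assumes groups: "partition_on UNIV \<G>"
    and weights: "\<And>G. G \<in> \<G> \<Longrightarrow> w G = real (card G)"
    and center: "0 \<le> vbar"
    and covariance: "pos_semidef S" "invertible S"
    and slater: "\<exists>v. ellipsoid_form vbar S v < r\<^sup>2 \<and> (\<forall>p. 0 < v $ p)"
    and A: "A = feasible_allocations \<kappa>l \<kappa>u \<psi>l \<psi>u c"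
    and V: "V = truncated_ellipsoid vbar S r"
    and \<Lambda>: "\<Lambda> = downward_closure A"
  shows
    \<comment> \<open>the robust problem and its equivalence with the dual problem\<close>
    "(\<forall>(a :: real^('n \<times> 'm)) v. welfare \<G> w a v = a \<bullet> v)
     \<and> (\<forall>a\<in>A. \<exists>v. is_arg_min (\<lambda>v. welfare \<G> w a v) (\<lambda>v. v \<in> V) v)
     \<and> (A \<noteq> {} \<longrightarrow> (\<exists>a. robust_optimal A V (welfare \<G> w) a))
     \<and> (A \<noteq> {} \<longrightarrow> (\<exists>l x. dual_optimal \<Lambda> vbar S r l x))
     \<and> (SUP a\<in>A. INF v\<in>V. ereal (welfare \<G> w a v))
         = (SUP (l, x)\<in>{0..} \<times> \<Lambda>. dual_objective vbar S r l x)
     \<and> (\<forall>a. robust_optimal A V (welfare \<G> w) a \<longrightarrow> (\<exists>l x. dual_optimal \<Lambda> vbar S r l x \<and> x \<le> a))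
     \<comment> \<open>the two steps\<close>
     \<and> (\<forall>x\<in>\<Lambda>. \<forall>l. multiplier_step vbar S r x l \<longleftrightarrow> l = sqrt (x \<bullet> (S *v x)) / (2 * \<bar>r\<bar>))
     \<and> polyhedron \<Lambda>
     \<and> (\<forall>l>0. concave_on \<Lambda> (\<lambda>x. x \<bullet> vbar - (x \<bullet> (S *v x)) / (4 * l) - l * r\<^sup>2))
     \<and> (A \<noteq> {} \<longrightarrow> (\<forall>l\<ge>0. \<exists>x. quadratic_step \<Lambda> vbar S r l x))
     \<comment> \<open>convergence to an exact optimum\<close>
     \<and> (\<forall>l x. alternating_run \<Lambda> vbar S r l x \<and> x 0 \<noteq> 0 \<longrightarrow>
          (\<exists>ls xs. l \<longlonglongrightarrow> ls \<and> x \<longlonglongrightarrow> xs \<and> dual_optimal \<Lambda> vbar S r ls xs))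
     \<comment> \<open>recovery of an optimal allocation\<close>
     \<and> (\<forall>ls xs. dual_optimal \<Lambda> vbar S r ls xs \<longrightarrow>
          (\<exists>a\<in>A. \<forall>G\<in>\<G>. group_restrict G xs \<le> group_restrict G a)
          \<and> (\<forall>a\<in>A. (\<forall>G\<in>\<G>. group_restrict G xs \<le> group_restrict G a)
               \<longrightarrow> robust_optimal A V (welfare \<G> w) a))"
proof -
  have W: "welfare \<G> w = ((\<bullet>) :: real^('n \<times> 'm) \<Rightarrow> _)"
    by (intro ext welfare_eq_inner groups weights)
  obtain v0 where "ellipsoid_form vbar S v0 < r\<^sup>2" "\<And>p. 0 < v0 $ p" using slater by blast
  then have slater_ell: "slater_ellipsoid vbar S r v0"
    using covariance by unfold_locales
  interpret slater_ellipsoid vbar S r v0 by (rule slater_ell)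
  have poly: "polytope A" unfolding A by (rule polytope_feasible_allocations)
  have "\<And>a. a \<in> A \<Longrightarrow> 0 \<le> a" by (simp add: A feasible_allocations_def)
  then have dual: "\<exists>M. concave_dual vbar S r v0 \<Lambda> M" if "A \<noteq> {}"
    unfolding \<Lambda> using concave_dual_downward_closure[OF slater_ell poly that] by blast
  have polyhedron: "polyhedron \<Lambda>" unfolding \<Lambda> by (rule polyhedron_downward_closure[OF poly])
  have \<Lambda>_nonempty: "A \<noteq> {}" if "x \<in> \<Lambda>" for x using that by (auto simp: \<Lambda> downward_closure_def)
  have above: "\<exists>a\<in>A. x \<le> a" if "dual_optimal \<Lambda> vbar S r l x" for l x
    using that by (simp add: \<Lambda> dual_optimal_iff downward_closure_iff)
  have dual_opt: "\<exists>l x. dual_optimal \<Lambda> vbar S r l x" if ne: "A \<noteq> {}"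
  proof -
    obtain M where "concave_dual vbar S r v0 \<Lambda> M" using dual[OF ne] by blast
    then interpret concave_dual vbar S r v0 \<Lambda> M .
    show ?thesis using worst_value_maximum_exists by (auto simp: dual_optimal_iff)
  qed
  show ?thesis
    unfolding W group_restrict_le_iff[OF groups]
  proof (intro conjI allI ballI impI)
    show "\<exists>v. is_arg_min ((\<bullet>) a) (\<lambda>v. v \<in> V) v" for a
      using inner_minimum_exists[of a] by (auto simp: V is_arg_min_linorder)
    show "\<exists>a. robust_optimal A V (\<bullet>) a" if "A \<noteq> {}"
      using dual_opt[OF that] above robust_optimal_above_dual_optimal unfolding V \<Lambda> by metis
    show "\<exists>l x. dual_optimal \<Lambda> vbar S r l x" if "A \<noteq> {}" using dual_opt[OF that] .
    show "(SUP a\<in>A. INF v\<in>V. ereal (a \<bullet> v)) = (SUP (l, x)\<in>{0..} \<times> \<Lambda>. dual_objective vbar S r l x)"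
      unfolding V \<Lambda> by (rule robust_value_eq_dual_value)
    show "\<exists>l x. dual_optimal \<Lambda> vbar S r l x \<and> x \<le> a" if "robust_optimal A V (\<bullet>) a" for a
      using dual_optimal_below_robust_optimal that unfolding V \<Lambda> .
    show "multiplier_step vbar S r x l \<longleftrightarrow> l = sqrt (x \<bullet> (S *v x)) / (2 * \<bar>r\<bar>)" for x l
      by (simp add: multiplier_step_iff multiplier_def cov_norm_def)
    show "polyhedron \<Lambda>" by (rule polyhedron)
    show "concave_on \<Lambda> (\<lambda>x. x \<bullet> vbar - (x \<bullet> (S *v x)) / (4 * l) - l * r\<^sup>2)" if "l > 0" for l
      by (intro concave_on_dual_objective polyhedron_imp_convex polyhedron that)
    show "\<exists>x. quadratic_step \<Lambda> vbar S r l x" if "A \<noteq> {}" "0 \<le> l" for l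
      using dual[OF that(1)] concave_dual.quadratic_step_exists that(2) by blast
    show "\<exists>ls xs. l \<longlonglongrightarrow> ls \<and> x \<longlonglongrightarrow> xs \<and> dual_optimal \<Lambda> vbar S r ls xs"
      if run: "alternating_run \<Lambda> vbar S r l x \<and> x 0 \<noteq> 0" for l x
    proof -
      \<comment> \<open>A run starts in \<open>\<Lambda>\<close>, which is empty when
        \<open>A\<close> is.\<close>
      have "A \<noteq> {}" using run \<Lambda>_nonempty by (auto simp: alternating_run_def)
      then obtain M where "concave_dual vbar S r v0 \<Lambda> M" using dual by blast
      then show ?thesis using concave_dual.alternating_converges run by blast
    qed
    show "\<exists>a\<in>A. x \<le> a" if "dual_optimal \<Lambda> vbar S r l x" for l x using above[OF that] .
    show "robust_optimal A V (\<bullet>) a" if "dual_optimal \<Lambda> vbar S r l x" "a \<in> A" "x \<le> a" for l x a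
      using robust_optimal_above_dual_optimal that unfolding V \<Lambda> by blast
  qed simp
qed

end
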